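(* Let $S_0$ be the Riemann sphere, the complex plane, or the open unit disk, let $S_1=S_2=\dots=S_0$, and let $f_i:S_{i+1}\to S_i$ ($i=1,2,\dots$) be holomorphic branched coverings with $1<\deg(f_i)<\infty$. If $\deg(f_{i+1})\le 2\deg(f_i)$ for all $i=1,2,\dots$, then the set $\Delta$ of all regular points of the plaque inverse limit $S_\infty$ of the inverse system $S_1\xleftarrow{f_1}S_2\xleftarrow{f_2}S_3\leftarrow\cdots$ is not empty.
   Context: The plaque inverse limit $S_\infty$ of an inverse system $S_1\xleftarrow{f_1}S_2\xleftarrow{f_2}\cdots$ of Riemann surfaces and holomorphic branched coverings is the set of all sequences $x=(x_1,x_2,\dots)$ with $x_i\in S_i$ and $f_i(x_{i+1})=x_i$ for all $i$, with the topology generated by the sets given by sequences $U=(U_1,U_2,\dots)$ of open sets $U_i\subset S_i$ with $f_i(U_{i+1})=U_i$ for all $i$ (such a $U$ being identified with the set of $x\in S_\infty$ with $x_i\in U_i$ for all $i$). A plaque is such an open set $U$ in which each $U_i$ is conformally equivalent to the unit disk and each $f_i|_{U_{i+1}}$ is conformally equivalent to a self-map $z\mapsto z^t$ of the unit disk, $t\le\deg(f_i)$. Plaques containing $x$ form a local base at $x$, and open neighborhoods of points of $S_\infty$ are always assumed to be plaques. A point $x\in S_\infty$ is regular if there are an open neighborhood $U$ of $x$ and a positive integer $n$ such that $f_i:U_{i+1}\to U_i$ is a bijection for all $i\ge n$; otherwise $x$ is irregular. *)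

theory Defs
  imports "HOL-Complex_Analysis.Complex_Analysis" "HOL-Library.Extended_Nat"
begin

text \<open>
  The Riemann sphere is obtained by gluing two copies of the plane along \<open>z \<mapsto> 1/z\<close>.  The plane
  and the unit disk are treated as open subsets of it, so every Riemann surface below is a set
  of points of the sphere with the induced complex structure.
\<close>

datatype sphere = Fin complex | Infinity

fun sphere_inverse :: "sphere \<Rightarrow> sphere" where
  "sphere_inverse (Fin z) = (if z = 0 then Infinity else Fin (inverse z))"
| "sphere_inverse Infinity = Fin 0"

text \<open>The value at \<open>Infinity\<close> is a dummy.\<close>

fun coord :: "sphere \<Rightarrow> complex" where
  "coord (Fin z) = z"
| "coord Infinity = 0"

instantiation sphere :: topological_space
begin

definition open_sphere :: "sphere set \<Rightarrow> bool" where
  "open_sphere U \<longleftrightarrow> open {z. Fin z \<in> U} \<and> open {z. sphere_inverse (Fin z) \<in> U}"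

instance
proof
  show "open (UNIV :: sphere set)"
    by (simp add: open_sphere_def)
next
  fix S T :: "sphere set"
  assume "open S" "open T"
  then show "open (S \<inter> T)"
    by (auto simp: open_sphere_def Collect_conj_eq simp del: sphere_inverse.simps intro!: open_Int)
next
  fix K :: "sphere set set"
  assume K: "\<forall>S\<in>K. open S"
  have "{z. Fin z \<in> \<Union>K} = (\<Union>S\<in>K. {z. Fin z \<in> S})"
    and "{z. sphere_inverse (Fin z) \<in> \<Union>K} = (\<Union>S\<in>K. {z. sphere_inverse (Fin z) \<in> S})"
    by auto
  with K show "open (\<Union>K)"
    by (auto simp: open_sphere_def simp del: sphere_inverse.simps)
qed

end

definition unit_disk :: "sphere set" where
  "unit_disk = Fin ` ball 0 1"

text \<open>
  The maps \<open>a \<circ> Fin\<close> for \<open>a \<in> {id, sphere_inverse}\<close> parametrize the two coordinate patches; as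
  both choices of \<open>a\<close> are involutions, \<open>coord \<circ> b\<close> is the coordinate on the patch of \<open>b\<close>,
  which consists of the points \<open>p\<close> with \<open>b p \<noteq> Infinity\<close>.
\<close>

definition sphere_holomorphic_on :: "(sphere \<Rightarrow> sphere) \<Rightarrow> sphere set \<Rightarrow> bool" where
  "sphere_holomorphic_on f U \<longleftrightarrow>
     open U \<and> continuous_on U f \<and>
     (\<forall>a\<in>{id, sphere_inverse}. \<forall>b\<in>{id, sphere_inverse}.
        (\<lambda>z. coord (b (f (a (Fin z)))))
          holomorphic_on {z. a (Fin z) \<in> U \<and> b (f (a (Fin z))) \<noteq> Infinity})"

definition conformal_equivalence :: "sphere set \<Rightarrow> sphere set \<Rightarrow> (sphere \<Rightarrow> sphere) \<Rightarrow> bool" where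
  "conformal_equivalence U V \<phi> \<longleftrightarrow>
     bij_betw \<phi> U V \<and> sphere_holomorphic_on \<phi> U \<and> sphere_holomorphic_on (inv_into U \<phi>) V"

text \<open>
  In the disk coordinates \<open>\<phi>\<close> on \<open>U\<close> and \<open>\<psi>\<close> on \<open>V\<close>, the restriction of \<open>f\<close> to \<open>U\<close> is
  \<open>z \<mapsto> z ^ t\<close>.
\<close>

definition power_map_in_coords ::
  "sphere set \<Rightarrow> sphere set \<Rightarrow> (sphere \<Rightarrow> sphere) \<Rightarrow> (sphere \<Rightarrow> sphere) \<Rightarrow> (sphere \<Rightarrow> sphere)
    \<Rightarrow> nat \<Rightarrow> bool" where
  "power_map_in_coords U V f \<phi> \<psi> t \<longleftrightarrow>
     1 \<le> t \<and> conformal_equivalence U unit_disk \<phi> \<and> conformal_equivalence V unit_disk \<psi> \<and>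
     f ` U \<subseteq> V \<and> (\<forall>x\<in>U. \<psi> (f x) = Fin (coord (\<phi> x) ^ t))"

definition branched_covering :: "sphere set \<Rightarrow> sphere set \<Rightarrow> (sphere \<Rightarrow> sphere) \<Rightarrow> bool" where
  "branched_covering X Y f \<longleftrightarrow>
     sphere_holomorphic_on f X \<and> f ` X = Y \<and>
     (\<forall>y\<in>Y. \<exists>V \<psi>. open V \<and> y \<in> V \<and> V \<subseteq> Y \<and>
        conformal_equivalence V unit_disk \<psi> \<and> \<psi> y = Fin 0 \<and>
        (\<forall>U\<in>components {x \<in> X. f x \<in> V}. \<exists>\<phi> t. power_map_in_coords U V f \<phi> \<psi> t))"

definition branch_points :: "sphere set \<Rightarrow> (sphere \<Rightarrow> sphere) \<Rightarrow> sphere set" where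
  "branch_points X f = {x \<in> X. \<nexists>N. open N \<and> x \<in> N \<and> N \<subseteq> X \<and> inj_on f N}"

definition fibre_size :: "sphere set \<Rightarrow> (sphere \<Rightarrow> sphere) \<Rightarrow> sphere \<Rightarrow> enat" where
  "fibre_size X f y =
     (if finite {x \<in> X. f x = y} then enat (card {x \<in> X. f x = y}) else \<infinity>)"

text \<open>
  The degree is the number of preimages of any point that is not the image of a branch point.
  It is well defined for a branched covering of a connected surface.
\<close>

definition covering_degree :: "sphere set \<Rightarrow> sphere set \<Rightarrow> (sphere \<Rightarrow> sphere) \<Rightarrow> enat" where
  "covering_degree X Y f = (THE d. \<forall>y \<in> Y - f ` branch_points X f. fibre_size X f y = d)"

text \<open>
  Inverse systems are indexed from 0: \<open>S i\<close> and \<open>f i\<close> stand for the surface and the bonding map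
  with index \<open>i + 1\<close> in the usual notation, and \<open>f i\<close> maps \<open>S (Suc i)\<close> to \<open>S i\<close>.
\<close>

definition threads :: "(nat \<Rightarrow> sphere \<Rightarrow> sphere) \<Rightarrow> (nat \<Rightarrow> sphere set) \<Rightarrow> (nat \<Rightarrow> sphere) set" where
  "threads f U = {x. \<forall>i. x i \<in> U i \<and> f i (x (Suc i)) = x i}"

definition open_sequence ::
  "(nat \<Rightarrow> sphere set) \<Rightarrow> (nat \<Rightarrow> sphere \<Rightarrow> sphere) \<Rightarrow> (nat \<Rightarrow> sphere set) \<Rightarrow> bool" where
  "open_sequence S f U \<longleftrightarrow> (\<forall>i. open (U i) \<and> U i \<subseteq> S i \<and> f i ` U (Suc i) = U i)"

definition plaque_inverse_limit ::
  "(nat \<Rightarrow> sphere set) \<Rightarrow> (nat \<Rightarrow> sphere \<Rightarrow> sphere) \<Rightarrow> (nat \<Rightarrow> sphere) topology" where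
  "plaque_inverse_limit S f = topology_generated_by (threads f ` Collect (open_sequence S f))"

text \<open>The generators cover the full set of threads as soon as the bonding maps are onto.\<close>

lemma topspace_plaque_inverse_limit:
  assumes "\<And>i. open (S i)" and "\<And>i. f i ` S (Suc i) = S i"
  shows "topspace (plaque_inverse_limit S f) = threads f S"
proof -
  have "open_sequence S f S"
    using assms by (simp add: open_sequence_def)
  moreover have "threads f U \<subseteq> threads f S" if "open_sequence S f U" for U
    using that unfolding open_sequence_def threads_def by blast
  ultimately show ?thesis
    by (auto simp: plaque_inverse_limit_def)
qed

definition plaque ::
  "(nat \<Rightarrow> sphere set) \<Rightarrow> (nat \<Rightarrow> sphere \<Rightarrow> sphere) \<Rightarrow> (nat \<Rightarrow> sphere set) \<Rightarrow> bool" where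
  "plaque S f U \<longleftrightarrow>
     open_sequence S f U \<and>
     (\<forall>i. \<exists>\<phi>. conformal_equivalence (U i) unit_disk \<phi>) \<and>
     (\<forall>i. \<exists>\<phi> \<psi> t. power_map_in_coords (U (Suc i)) (U i) (f i) \<phi> \<psi> t \<and>
            enat t \<le> covering_degree (S (Suc i)) (S i) (f i))"

text \<open>Open neighborhoods of points of the limit are understood to be plaques.\<close>

definition regular_points ::
  "(nat \<Rightarrow> sphere set) \<Rightarrow> (nat \<Rightarrow> sphere \<Rightarrow> sphere) \<Rightarrow> (nat \<Rightarrow> sphere) set" where
  "regular_points S f =
     {x \<in> topspace (plaque_inverse_limit S f).
        \<exists>U n. plaque S f U \<and> x \<in> threads f U \<and> (\<forall>i\<ge>n. bij_betw (f i) (U (Suc i)) (U i))}"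

end

theory Submission
  imports Defs
begin

text \<open>
  A branched covering of degree \<open>d\<close> of the sphere, the plane or the disk is given by a rational
  function \<open>P / Q\<close> of degree \<open>d\<close> in a suitable coordinate on the target (on the disk, by a Blaschke
  product), so its branch points are zeros of \<open>P' Q - P Q'\<close> and there are at most \<open>2 d\<close> of them in the
  plane.  Counting also the image of \<open>Infinity\<close>, there are at most \<open>2 d + 1\<close> exceptional values, and a
  simply connected open set in the plane that avoids them has \<open>d\<close> disjoint homeomorphic preimages
  in the plane.

  Start with a large finite family of disjoint disks and pass repeatedly to the preimages of those
  members that avoid the exceptional values of the next map.  From \<open>m\<close> members one obtains at least
  \<open>d (m - (2 d + 1))\<close>, and \<open>m \<ge> 2 d + 10\<close> reproduces itself because the next degree is at most \<open>2 d\<close>.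
  So no family is empty, and by Koenig's lemma there is a sequence of disks each of which is mapped
  bijectively onto its predecessor; this is a plaque all of whose points are regular.
\<close>

section \<open>The topology of the sphere and branched disk neighbourhoods\<close>

text \<open>The definition of a branched covering is local and its degree is a fibre count blind to
  multiplicities, so the rational form of \<open>f\<close> has to be extracted. Finite degree leaves
  finitely many sheets over each small disk, hence properness: preimages of compact sets stay in
  compact sets. On the plane this excludes an essential singularity at infinity, on the disk it
  supplies the boundary behaviour. At a regular value \<open>w\<close> every preimage is simple, so
  the fibre count bounds the degrees of numerator and denominator. \<open>f Infinity\<close> is made
  exceptional in order that all members of a family stay in the complex plane, where lifting through
  coverings, invariance of domain and the Riemann mapping theorem apply. A member that meets an
  exceptional value is given no preimages, so a sequence cannot be chosen greedily; finiteness of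
  the families is what permits a limit argument.\<close>

lemma sphere_inverse_inverse [simp]: "sphere_inverse (sphere_inverse p) = p"
  by (cases p) auto

lemma open_vimage_Fin: "open U \<Longrightarrow> open (Fin -` U)"
  by (simp add: open_sphere_def vimage_def)

lemma open_vimage_sphere_inverse: "open U \<Longrightarrow> open (sphere_inverse -` U)"
  by (simp add: open_sphere_def vimage_def del: sphere_inverse.simps)

lemma open_image_Fin:
  assumes "open A"
  shows "open (Fin ` A)"
proof -
  have "{z. sphere_inverse (Fin z) \<in> Fin ` A} = inverse -` A \<inter> (- {0})"
    by auto
  moreover have "open (inverse -` A \<inter> (- {0}))"
  proof -
    have "continuous_on (- {0}) (inverse :: complex \<Rightarrow> complex)"
      by (intro continuous_intros) auto
    moreover have "open (- {0 :: complex})"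
      by (simp add: open_Compl)
    ultimately show ?thesis
      using assms continuous_on_open_vimage by blast
  qed
  moreover have "{z. Fin z \<in> Fin ` A} = A"
    by auto
  ultimately show ?thesis
    using assms by (simp add: open_sphere_def)
qed

lemma continuous_on_Fin [continuous_intros]: "continuous_on A Fin"
  by (metis UNIV_I continuous_on_open_vimage continuous_on_subset open_UNIV open_vimage_Fin
      subset_UNIV Int_UNIV_right)

lemma continuous_on_coord: "continuous_on (range Fin) coord"
proof -
  have "coord -` B \<inter> range Fin = Fin ` B" for B
    by force
  moreover have "open (range Fin)"
    by (simp add: open_image_Fin)
  ultimately show ?thesis
    by (simp add: continuous_on_open_vimage open_image_Fin)
qed

lemma neighbourhood_of_Infinity:
  assumes "open N" "Infinity \<in> N"
  obtains R where "\<And>z. R < norm z \<Longrightarrow> Fin z \<in> N"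
proof -
  have "open {z. sphere_inverse (Fin z) \<in> N}"
    using assms(1) by (simp add: open_sphere_def)
  moreover have "0 \<in> {z. sphere_inverse (Fin z) \<in> N}"
    using assms(2) by simp
  ultimately obtain d where d: "d > 0" "ball 0 d \<subseteq> {z. sphere_inverse (Fin z) \<in> N}"
    by (meson open_contains_ball)
  show thesis
  proof
    fix z :: complex
    assume z: "1 / d < norm z"
    then have "z \<noteq> 0"
      using d(1) by (auto simp: not_less)
    have "norm (inverse z) < d"
      unfolding norm_inverse using d(1) z \<open>z \<noteq> 0\<close> by (simp add: field_simps)
    then have "inverse z \<in> ball 0 d"
      by simp
    then have "sphere_inverse (Fin (inverse z)) \<in> N"
      using d(2) by blast
    then show "Fin z \<in> N"
      using \<open>z \<noteq> 0\<close> by simp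
  qed
qed

text \<open>Only the homeomorphism is kept from a conformal equivalence: fibre counts, properness
  and covering spaces are topological, and analytic statements about \<open>f\<close> come from its
  own holomorphy.\<close>

definition disk_chart :: "sphere set \<Rightarrow> (sphere \<Rightarrow> complex) \<Rightarrow> bool" where
  "disk_chart U \<theta> \<longleftrightarrow> open U \<and> bij_betw \<theta> U (ball 0 1) \<and> continuous_on U \<theta> \<and>
     continuous_on (ball 0 1) (inv_into U \<theta>)"

lemma conformal_equivalence_disk_chart:
  assumes "conformal_equivalence U unit_disk \<phi>"
  shows "disk_chart U (coord \<circ> \<phi>)"
proof -
  have bij: "bij_betw \<phi> U unit_disk" and opn: "open U" and cont: "continuous_on U \<phi>"
    and cinv: "continuous_on unit_disk (inv_into U \<phi>)"
    using assms by (auto simp: conformal_equivalence_def sphere_holomorphic_on_def)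
  have im: "\<phi> ` U = Fin ` ball 0 1"
    using bij by (simp add: bij_betw_def unit_disk_def)
  have bc: "bij_betw coord unit_disk (ball 0 1)"
    unfolding unit_disk_def by (rule bij_betwI[where g = Fin]) auto
  have bij': "bij_betw (coord \<circ> \<phi>) U (ball 0 1)"
    using bij bc by (rule bij_betw_trans)
  have "continuous_on U (coord \<circ> \<phi>)"
    using cont by (rule continuous_on_compose)
      (use im in \<open>auto intro: continuous_on_subset[OF continuous_on_coord]\<close>)
  moreover have "continuous_on (ball 0 1) (inv_into U (coord \<circ> \<phi>))"
  proof (rule continuous_on_eq)
    show "continuous_on (ball 0 1) (inv_into U \<phi> \<circ> Fin)"
      by (rule continuous_on_compose[OF continuous_on_Fin]) (use cinv in \<open>simp add: unit_disk_def\<close>)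
    fix z :: complex
    assume z: "z \<in> ball 0 1"
    have "inv_into U \<phi> (Fin z) \<in> U" "\<phi> (inv_into U \<phi> (Fin z)) = Fin z"
      using z im by (auto intro: inv_into_into f_inv_into_f)
    then show "(inv_into U \<phi> \<circ> Fin) z = inv_into U (coord \<circ> \<phi>) z"
      using inv_into_f_f[OF bij_betw_imp_inj_on[OF bij']] by force
  qed
  ultimately show ?thesis
    using opn bij' by (simp add: disk_chart_def)
qed

lemma disk_chartD:
  assumes "disk_chart U \<theta>"
  shows "open U" "inj_on \<theta> U" "\<theta> ` U = ball 0 1" "continuous_on U \<theta>"
    "continuous_on (ball 0 1) (inv_into U \<theta>)"
  using assms by (auto simp: disk_chart_def bij_betw_def)

lemma disk_chart_inv:
  assumes "disk_chart U \<theta>" "norm z < 1"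
  shows "inv_into U \<theta> z \<in> U" "\<theta> (inv_into U \<theta> z) = z"
  using disk_chartD(3)[OF assms(1)] assms(2) by (auto intro: inv_into_into f_inv_into_f)

lemma disk_chart_open_image:
  assumes \<theta>: "disk_chart U \<theta>" and "open N" "N \<subseteq> U"
  shows "open (\<theta> ` N)"
proof -
  have "\<theta> ` N = inv_into U \<theta> -` N \<inter> ball 0 1"
  proof (intro subset_antisym subsetI)
    fix z assume "z \<in> \<theta> ` N"
    then show "z \<in> inv_into U \<theta> -` N \<inter> ball 0 1"
      using disk_chartD[OF \<theta>] assms(3) by (auto simp: subset_iff)
  next
    fix z assume "z \<in> inv_into U \<theta> -` N \<inter> ball 0 1"
    then show "z \<in> \<theta> ` N"
      using disk_chart_inv[OF \<theta>, of z] by (metis IntD1 IntD2 imageI mem_ball_0 vimageE)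
  qed
  then show ?thesis
    using continuous_on_open_vimage[of "ball 0 1" "inv_into U \<theta>"] disk_chartD(5)[OF \<theta>] assms(2)
    by auto
qed

text \<open>
  The coordinates of \<^const>\<open>power_map_in_coords\<close>, with complex values: \<open>\<kappa>\<close> on \<open>V\<close> and \<open>\<theta> U\<close> on the
  component \<open>U\<close> of the preimage of \<open>V\<close>, where \<open>f\<close> becomes \<open>z \<mapsto> z ^ t U\<close>.
\<close>

locale branched_nbhd =
  fixes X :: "sphere set" and f :: "sphere \<Rightarrow> sphere" and V :: "sphere set" and y :: sphere
    and \<kappa> :: "sphere \<Rightarrow> complex" and \<theta> :: "sphere set \<Rightarrow> sphere \<Rightarrow> complex"
    and t :: "sphere set \<Rightarrow> nat"
  assumes y_in: "y \<in> V" and \<kappa>: "disk_chart V \<kappa>" and \<kappa>_y: "\<kappa> y = 0"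
    and \<theta>: "\<And>U. U \<in> components {x \<in> X. f x \<in> V} \<Longrightarrow> disk_chart U (\<theta> U)"
    and t_pos: "\<And>U. U \<in> components {x \<in> X. f x \<in> V} \<Longrightarrow> 1 \<le> t U"
    and \<kappa>_f: "\<And>U x. U \<in> components {x \<in> X. f x \<in> V} \<Longrightarrow> x \<in> U \<Longrightarrow> \<kappa> (f x) = \<theta> U x ^ t U"
begin

abbreviation sheets :: "sphere set set" where "sheets \<equiv> components {x \<in> X. f x \<in> V}"

lemma Union_sheets: "\<Union>sheets = {x \<in> X. f x \<in> V}"
  by (rule Union_components)

lemma sheet_subset: "U \<in> sheets \<Longrightarrow> U \<subseteq> {x \<in> X. f x \<in> V}"
  by (rule in_components_subset)

lemma sheetE:
  assumes "x \<in> X" "f x \<in> V"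
  obtains U where "U \<in> sheets" "x \<in> U"
proof -
  have "x \<in> \<Union>sheets"
    using assms by (simp only: Union_sheets) simp
  then show thesis
    using that by (elim UnionE)
qed

lemma sheets_disjoint: "U \<in> sheets \<Longrightarrow> U' \<in> sheets \<Longrightarrow> x \<in> U \<Longrightarrow> x \<in> U' \<Longrightarrow> U = U'"
  using components_eq by blast

lemma \<kappa>_norm: "v \<in> V \<Longrightarrow> norm (\<kappa> v) < 1"
  using disk_chartD(3)[OF \<kappa>] by auto

lemma \<kappa>_eq_iff: "v \<in> V \<Longrightarrow> w \<in> V \<Longrightarrow> \<kappa> v = \<kappa> w \<longleftrightarrow> v = w"
  using disk_chartD(2)[OF \<kappa>] by (auto simp: inj_on_eq_iff)

text \<open>As \<open>\<kappa>\<close> is injective, points over \<open>v\<close> correspond to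
  roots of \<open>z ^ t U = \<kappa> v\<close>; every such root lies in the unit disk because
  \<open>\<kappa> v\<close> does.\<close>

lemma sheet_fibre:
  assumes U: "U \<in> sheets" and v: "v \<in> V"
  shows "bij_betw (\<theta> U) {x \<in> U. f x = v} {z. z ^ t U = \<kappa> v}"
proof -
  have eq: "f x = v \<longleftrightarrow> \<theta> U x ^ t U = \<kappa> v" if "x \<in> U" for x
  proof -
    have "f x \<in> V"
      using sheet_subset[OF U] that by auto
    then show ?thesis
      using \<kappa>_eq_iff[OF _ v] \<kappa>_f[OF U that] by metis
  qed
  show ?thesis
  proof (rule bij_betw_imageI)
    show "inj_on (\<theta> U) {x \<in> U. f x = v}"
      by (rule inj_on_subset[OF disk_chartD(2)[OF \<theta>[OF U]]]) auto
    show "\<theta> U ` {x \<in> U. f x = v} = {z. z ^ t U = \<kappa> v}"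
    proof (intro subset_antisym subsetI)
      fix z assume "z \<in> {z. z ^ t U = \<kappa> v}"
      then have z: "z ^ t U = \<kappa> v"
        by simp
      then have "norm z ^ t U < 1"
        using \<kappa>_norm[OF v] by (metis norm_power)
      then have "norm z < 1"
        by (meson not_le one_le_power)
      then have "inv_into U (\<theta> U) z \<in> U" "\<theta> U (inv_into U (\<theta> U) z) = z"
        using disk_chart_inv[OF \<theta>[OF U]] by auto
      then show "z \<in> \<theta> U ` {x \<in> U. f x = v}"
        using eq z by (intro image_eqI[of _ _ "inv_into U (\<theta> U) z"]) auto
    qed (use eq in auto)
  qed
qed

lemma sheet_fibre_nonempty:
  assumes U: "U \<in> sheets" and v: "v \<in> V"
  obtains x where "x \<in> U" "f x = v"
proof -
  obtain z where "z ^ t U = \<kappa> v"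
    using exists_complex_root t_pos[OF U] by (metis not_one_le_zero)
  then show ?thesis
    using sheet_fibre[OF assms] that unfolding bij_betw_def by blast
qed

text \<open>In the coordinates \<open>f\<close> is \<open>z \<mapsto> z ^ t\<close>, whose
  derivative vanishes only at 0 and only for \<open>t \<ge> 2\<close>; elsewhere the map is locally
  injective.\<close>

lemma sheet_branch_point:
  assumes U: "U \<in> sheets" and x: "x \<in> U"
  shows "x \<in> branch_points X f \<longleftrightarrow> 2 \<le> t U \<and> \<theta> U x = 0"
proof
  assume *: "2 \<le> t U \<and> \<theta> U x = 0"
  show "x \<in> branch_points X f"
    unfolding branch_points_def
  proof (intro CollectI conjI notI)
    show "x \<in> X"
      using sheet_subset[OF U] x by auto
    assume "\<exists>N. open N \<and> x \<in> N \<and> N \<subseteq> X \<and> inj_on f N"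
    then obtain N where N: "open N" "x \<in> N" "inj_on f N"
      by blast
    have "open (\<theta> U ` (N \<inter> U))"
      using N(1) disk_chartD(1)[OF \<theta>[OF U]] by (intro disk_chart_open_image[OF \<theta>[OF U]]) auto
    moreover have "0 \<in> \<theta> U ` (N \<inter> U)"
      using * x N(2) by (metis IntI imageI)
    ultimately obtain e where e: "e > 0" "ball 0 e \<subseteq> \<theta> U ` (N \<inter> U)"
      by (meson open_contains_ball)
    \<comment> \<open>A primitive root of unity: \<open>e / 2\<close> and
      \<open>e / 2 * \<zeta>\<close> are distinct points of the small disk with equal powers, so
      \<open>f\<close> identifies two points of \<open>N\<close>.\<close>
    define \<zeta> where "\<zeta> = cis (2 * pi / t U)"
    have \<zeta>: "\<zeta> ^ t U = 1"
      using * by (simp add: \<zeta>_def Complex.DeMoivre)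
    have "\<zeta> \<noteq> 1"
    proof
      assume "\<zeta> = 1"
      then have "cos (2 * pi / t U) = 1"
        by (simp add: \<zeta>_def cis.code complex_eq_iff)
      moreover have "cos (2 * pi / t U) < cos 0"
        using * by (intro cos_monotone_0_pi) (auto simp: field_simps)
      ultimately show False
        by simp
    qed
    have "complex_of_real (e / 2) \<in> ball 0 e" "complex_of_real (e / 2) * \<zeta> \<in> ball 0 e"
      using e(1) by (auto simp: norm_mult \<zeta>_def)
    then obtain a b where ab: "a \<in> N \<inter> U" "b \<in> N \<inter> U" "\<theta> U a = of_real (e / 2)"
      "\<theta> U b = of_real (e / 2) * \<zeta>"
    proof -
      obtain a where "a \<in> N \<inter> U" "of_real (e / 2) = \<theta> U a"
        using e(2) \<open>complex_of_real (e / 2) \<in> ball 0 e\<close> by blast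
      moreover obtain b where "b \<in> N \<inter> U" "of_real (e / 2) * \<zeta> = \<theta> U b"
        using e(2) \<open>complex_of_real (e / 2) * \<zeta> \<in> ball 0 e\<close> by blast
      ultimately show thesis
        by (intro that) simp_all
    qed
    have "\<theta> U b ^ t U = \<theta> U a ^ t U"
      using ab(3,4) \<zeta> by (simp only: power_mult_distrib) simp
    then have "\<kappa> (f a) = \<kappa> (f b)"
      using ab(1,2) \<kappa>_f[OF U] by simp
    then have "f a = f b"
      using ab sheet_subset[OF U] \<kappa>_eq_iff by blast
    then have "a = b"
      using N(3) ab by (meson IntD1 inj_onD)
    then show False
      using ab \<open>\<zeta> \<noteq> 1\<close> e(1) by simp
  qed
next
  assume br: "x \<in> branch_points X f"
  show "2 \<le> t U \<and> \<theta> U x = 0"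
  proof (rule ccontr)
    assume neg: "\<not> (2 \<le> t U \<and> \<theta> U x = 0)"
    have "deriv (\<lambda>z. z ^ t U) (\<theta> U x) = of_nat (t U) * \<theta> U x ^ (t U - 1)"
      by (rule DERIV_imp_deriv) (auto intro!: derivative_eq_intros)
    also have "\<dots> \<noteq> 0"
      using neg t_pos[OF U] by (cases "t U = 1") auto
    finally obtain r where r: "r > 0" "inj_on (\<lambda>z. z ^ t U) (ball (\<theta> U x) r)"
    proof (rule has_complex_derivative_locally_injective[rotated 3])
      show "(\<lambda>z. z ^ t U) holomorphic_on UNIV"
        by (intro holomorphic_intros)
    qed (use that in auto)
    define N where "N = \<theta> U -` ball (\<theta> U x) r \<inter> U"
    have "open N"
      unfolding N_def using disk_chartD[OF \<theta>[OF U]] continuous_on_open_vimage open_ball by blast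
    moreover have "x \<in> N" "N \<subseteq> X"
      using x r(1) sheet_subset[OF U] by (auto simp: N_def)
    moreover have "inj_on f N"
    proof (rule inj_onI)
      fix a b assume ab: "a \<in> N" "b \<in> N" "f a = f b"
      then have "\<theta> U a ^ t U = \<theta> U b ^ t U"
        using \<kappa>_f[OF U] by (metis IntD2 N_def)
      then have "\<theta> U a = \<theta> U b"
        using r(2) ab by (auto simp: N_def inj_on_def)
      then show "a = b"
        using ab disk_chartD(2)[OF \<theta>[OF U]] by (auto simp: N_def inj_on_def)
    qed
    ultimately show False
      using br by (auto simp: branch_points_def)
  qed
qed

text \<open>A branch point sits at the centre of its sheet, so its value has coordinate 0. Hence
  critical values are isolated.\<close>

lemma critical_value_eq:
  assumes "v \<in> V" "v \<in> f ` branch_points X f"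
  shows "v = y"
proof -
  obtain x where x: "x \<in> branch_points X f" "f x = v"
    using assms(2) by blast
  then obtain U where U: "U \<in> sheets" "x \<in> U"
    using assms(1) unfolding branch_points_def by (auto elim: sheetE)
  then have "\<kappa> v = \<kappa> y"
    using sheet_branch_point[OF U] x \<kappa>_f[OF U] t_pos[OF U(1)] \<kappa>_y by auto
  then show ?thesis
    using assms(1) y_in \<kappa>_eq_iff by blast
qed

text \<open>The point of a sheet over \<open>y\<close> is its centre, a branch point as soon as the
  exponent is at least 2. So over a regular centre every sheet is mapped homeomorphically.\<close>

lemma t_eq_1:
  assumes "y \<notin> f ` branch_points X f" and U: "U \<in> sheets"
  shows "t U = 1"
proof -
  obtain x where x: "x \<in> U" "f x = y"
    using sheet_fibre_nonempty[OF U y_in] by blast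
  then have "\<theta> U x = 0"
    using \<kappa>_f[OF U x(1)] \<kappa>_y by simp
  moreover have "x \<notin> branch_points X f"
    using assms(1) x by blast
  ultimately show ?thesis
    using sheet_branch_point[OF U x(1)] t_pos[OF U] by auto
qed

lemma card_sheet_fibre:
  assumes U: "U \<in> sheets" and v: "v \<in> V" "v \<notin> f ` branch_points X f"
  shows "finite {x \<in> U. f x = v}" "card {x \<in> U. f x = v} = t U"
proof -
  have "finite {z. z ^ t U = \<kappa> v} \<and> card {z. z ^ t U = \<kappa> v} = t U"
  proof (cases "v = y")
    \<comment> \<open>At the centre \<open>z ^ t U = 0\<close> has a single root, which agrees with
      \<open>t U\<close> only because regularity forces exponent 1.\<close>
    case True
    then show ?thesis
      using t_eq_1[OF _ U] v \<kappa>_y by simp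
  next
    case False
    then have "\<kappa> v \<noteq> 0"
      using \<kappa>_y \<kappa>_eq_iff[OF v(1) y_in] by simp
    then show ?thesis
      using card_nth_roots[of "\<kappa> v" "t U"] finite_nth_roots[of "t U" "\<kappa> v"] t_pos[OF U] by simp
  qed
  then show "finite {x \<in> U. f x = v}" "card {x \<in> U. f x = v} = t U"
    using bij_betw_finite[OF sheet_fibre[OF U v(1)]] bij_betw_same_card[OF sheet_fibre[OF U v(1)]]
    by simp_all
qed

text \<open>The right-hand side does not mention \<open>v\<close>, so the fibre size is constant on
  the regular values in \<open>V\<close>: the local half of the well-definedness of the
  degree.\<close>

lemma fibre_size_eq:
  assumes v: "v \<in> V" "v \<notin> f ` branch_points X f"
  shows "fibre_size X f v = (if finite sheets then enat (\<Sum>U\<in>sheets. t U) else \<infinity>)"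
proof -
  have eq: "{x \<in> X. f x = v} = (\<Union>U\<in>sheets. {x \<in> U. f x = v})"
  proof (intro subset_antisym subsetI)
    fix x assume "x \<in> {x \<in> X. f x = v}"
    then obtain U where "U \<in> sheets" "x \<in> U" "f x = v"
      using v(1) by (auto elim: sheetE)
    then show "x \<in> (\<Union>U\<in>sheets. {x \<in> U. f x = v})"
      by (intro UN_I) auto
  next
    fix x assume "x \<in> (\<Union>U\<in>sheets. {x \<in> U. f x = v})"
    then obtain U where "U \<in> sheets" "x \<in> U" "f x = v"
      by (elim UN_E) auto
    then show "x \<in> {x \<in> X. f x = v}"
      using sheet_subset by auto
  qed
  show ?thesis
  proof (cases "finite sheets")
    case True
    then have "finite {x \<in> X. f x = v}"
      using card_sheet_fibre[OF _ v] by (simp add: eq)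
    moreover have "card {x \<in> X. f x = v} = (\<Sum>U\<in>sheets. card {x \<in> U. f x = v})"
      unfolding eq
    proof (rule card_UN_disjoint)
      show "\<forall>U\<in>sheets. finite {x \<in> U. f x = v}"
        using card_sheet_fibre(1)[OF _ v] by blast
      show "\<forall>U\<in>sheets. \<forall>U'\<in>sheets. U \<noteq> U' \<longrightarrow> {x \<in> U. f x = v} \<inter> {x \<in> U'. f x = v} = {}"
        by (auto dest: sheets_disjoint)
    qed (use True in simp)
    ultimately show ?thesis
      using True card_sheet_fibre[OF _ v] by (simp add: fibre_size_def)
  next
    case False
    \<comment> \<open>One point over \<open>v\<close> from each of infinitely many disjoint sheets
      makes the fibre infinite.\<close>
    define s where "s U = (SOME x. x \<in> U \<and> f x = v)" for U
    have s: "s U \<in> U \<and> f (s U) = v" if U: "U \<in> sheets" for U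
    proof -
      obtain x where "x \<in> U \<and> f x = v"
        using sheet_fibre_nonempty[OF U v(1)] by blast
      then show ?thesis
        unfolding s_def by (rule someI)
    qed
    have "inj_on s sheets"
    proof (rule inj_onI)
      fix U U' assume "U \<in> sheets" "U' \<in> sheets" "s U = s U'"
      then show "U = U'"
        using s[of U] s[of U'] sheets_disjoint[of U U' "s U"] by simp
    qed
    moreover have "s ` sheets \<subseteq> {x \<in> X. f x = v}"
      using s sheet_subset by blast
    ultimately have "infinite {x \<in> X. f x = v}"
      using False finite_imageD finite_subset by blast
    then show ?thesis
      using False by (simp add: fibre_size_def)
  qed
qed

end

lemma branched_covering_nbhd:
  assumes "branched_covering X Y f" "y \<in> Y"
  obtains V \<kappa> \<theta> t where "branched_nbhd X f V y \<kappa> \<theta> t" "V \<subseteq> Y"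
proof -
  obtain V \<psi> where V: "open V" "y \<in> V" "V \<subseteq> Y" "conformal_equivalence V unit_disk \<psi>"
    "\<psi> y = Fin 0"
    and U: "\<forall>U\<in>components {x \<in> X. f x \<in> V}. \<exists>\<phi> t. power_map_in_coords U V f \<phi> \<psi> t"
    using assms unfolding branched_covering_def by meson
  obtain \<phi> t where U: "power_map_in_coords U V f (\<phi> U) \<psi> (t U)"
    if "U \<in> components {x \<in> X. f x \<in> V}" for U
    using U by metis
  have "branched_nbhd X f V y (coord \<circ> \<psi>) (\<lambda>U. coord \<circ> \<phi> U) t"
    by unfold_locales
      (use V U in \<open>auto simp: power_map_in_coords_def intro: conformal_equivalence_disk_chart\<close>)
  then show thesis
    using that V(3) by blast
qed

section \<open>The degree and properness\<close>

text \<open>Each branched neighbourhood contains at most one critical value, its centre, so they are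
  sparse. Countability is enough to keep the regular plane values connected and to find some in
  every nonempty open set.\<close>

lemma countable_critical_values:
  assumes cov: "branched_covering X Y f" and Y: "open Y"
  shows "countable {z. Fin z \<in> f ` branch_points X f}"
proof -
  let ?C = "{z. Fin z \<in> f ` branch_points X f}"
  have C_sub: "?C \<subseteq> Fin -` Y"
    using cov by (auto simp: branched_covering_def branch_points_def)
  have "?C sparse_in Fin -` Y"
    unfolding sparse_in_eventually_iff[OF open_vimage_Fin[OF Y]]
  proof
    fix w assume w: "w \<in> Fin -` Y"
    then have "Fin w \<in> Y"
      by simp
    then obtain V \<kappa> \<theta> t where "branched_nbhd X f V (Fin w) \<kappa> \<theta> t"
      by (rule branched_covering_nbhd[OF cov])
    then interpret branched_nbhd X f V "Fin w" \<kappa> \<theta> t .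
    have "open (Fin -` V)" "w \<in> Fin -` V"
      using y_in disk_chartD(1)[OF \<kappa>] by (auto intro: open_vimage_Fin)
    then show "\<forall>\<^sub>F z in at w. z \<notin> ?C"
      unfolding eventually_at_topological using critical_value_eq by blast
  qed
  then have "countable (Fin -` Y \<inter> ?C)"
    using open_vimage_Fin[OF Y] by (intro sparse_imp_countable)
  then show ?thesis
    using C_sub by (simp add: Int_absorb1)
qed

text \<open>\<open>covering_degree\<close> is a definite description, so a common fibre size must be
  shown to exist. The regular plane values form an open connected set minus a countable one, and the
  fibre size is locally constant there; a regular value at Infinity is compared with a nearby plane
  value.\<close>

lemma fibre_size_eq_covering_degree:
  assumes cov: "branched_covering X Y f" and Y: "open Y" "connected (Fin -` Y)" "Fin -` Y \<noteq> {}"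
    and y: "y \<in> Y" "y \<notin> f ` branch_points X f"
  shows "fibre_size X f y = covering_degree X Y f"
proof -
  let ?C = "f ` branch_points X f"
  define A where "A = Fin -` Y - {z. Fin z \<in> ?C}"
  have countable: "countable {z. Fin z \<in> ?C}"
    by (rule countable_critical_values[OF cov Y(1)])
  have dense: "\<exists>w\<in>A. Fin w \<in> N" if "open N" "p \<in> N" "N \<subseteq> Y" for N p
  proof -
    have "open (Fin -` N)"
      by (rule open_vimage_Fin) fact
    moreover have "Fin -` N \<noteq> {}"
    proof (cases p)
      case (Fin z)
      then show ?thesis
        using that by auto
    next
      case Infinity
      then obtain R where "\<And>z. R < norm z \<Longrightarrow> Fin z \<in> N"
        using neighbourhood_of_Infinity \<open>open N\<close> \<open>p \<in> N\<close> by metis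
      from this[of "of_real (\<bar>R\<bar> + 1)"] have "of_real (\<bar>R\<bar> + 1) \<in> Fin -` N"
        by (simp del: of_real_add)
      then show ?thesis
        by blast
    qed
    ultimately obtain a r where "r > 0" "ball a r \<subseteq> Fin -` N"
      by (meson ex_in_conv open_contains_ball)
    then have "uncountable (Fin -` N)"
      using uncountable_ball countable_subset by blast
    then obtain w where "w \<in> Fin -` N" "w \<notin> {z. Fin z \<in> ?C}"
      using countable by (meson countable_subset subsetI)
    then show ?thesis
      using \<open>N \<subseteq> Y\<close> by (auto simp: A_def)
  qed
  have const: "fibre_size X f (Fin a) = fibre_size X f (Fin b)" if ab: "a \<in> A" "b \<in> A" for a b
  proof (rule connected_local_const[of A _ _ "\<lambda>w. fibre_size X f (Fin w)"])
    show "connected A"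
      unfolding A_def using Y countable
      by (intro connected_open_diff_countable) (auto intro: open_vimage_Fin)
    show "\<forall>w\<in>A. \<forall>\<^sub>F z in at w within A. fibre_size X f (Fin w) = fibre_size X f (Fin z)"
    proof
      fix w assume w: "w \<in> A"
      then have "Fin w \<in> Y"
        by (simp add: A_def)
      then obtain V \<kappa> \<theta> t where "branched_nbhd X f V (Fin w) \<kappa> \<theta> t"
        by (rule branched_covering_nbhd[OF cov])
      then interpret branched_nbhd X f V "Fin w" \<kappa> \<theta> t .
      have "open (Fin -` V)" "w \<in> Fin -` V"
        using y_in disk_chartD(1)[OF \<kappa>] by (auto intro: open_vimage_Fin)
      moreover have "fibre_size X f (Fin w) = fibre_size X f (Fin z)"
        if "z \<in> A" "z \<in> Fin -` V" for z
        using that w y_in by (simp add: fibre_size_eq A_def)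
      ultimately show "\<forall>\<^sub>F z in at w within A. fibre_size X f (Fin w) = fibre_size X f (Fin z)"
        unfolding eventually_at_topological by blast
    qed
  qed (use ab in auto)
  have near: "\<exists>w\<in>A. fibre_size X f p = fibre_size X f (Fin w)" if p: "p \<in> Y - ?C" for p
  proof -
    have "p \<in> Y"
      using p by simp
    then obtain V \<kappa> \<theta> t where *: "branched_nbhd X f V p \<kappa> \<theta> t" "V \<subseteq> Y"
      by (rule branched_covering_nbhd[OF cov])
    then interpret branched_nbhd X f V p \<kappa> \<theta> t by simp
    obtain w where "w \<in> A" "Fin w \<in> V"
      using dense[OF disk_chartD(1)[OF \<kappa>] y_in *(2)] by blast
    then show ?thesis
      using fibre_size_eq y_in p by (intro bexI[of _ w]) (auto simp: A_def)
  qed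
  have const': "fibre_size X f p = fibre_size X f q" if "p \<in> Y - ?C" "q \<in> Y - ?C" for p q
    using near[OF that(1)] near[OF that(2)] const by metis
  show ?thesis
    unfolding covering_degree_def
  proof (rule sym, rule the_equality)
    show "\<forall>p\<in>Y - ?C. fibre_size X f p = fibre_size X f y"
      using const' y by blast
    then show "d = fibre_size X f y" if "\<forall>p\<in>Y - ?C. fibre_size X f p = d" for d
      using that y by auto
  qed
qed

lemma (in branched_nbhd) finite_sheets:
  assumes "v \<in> V" "v \<notin> f ` branch_points X f" "fibre_size X f v \<noteq> \<infinity>"
  shows "finite sheets"
  using fibre_size_eq[OF assms(1,2)] assms(3) by (auto split: if_splits)

text \<open>Where \<open>\<kappa>\<close> has modulus below 1/2, each sheet coordinate has modulus
  below the \<open>t U\<close>-th root of 1/2, which is less than 1. So the preimage lies in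
  finitely many compact disks.\<close>

lemma (in branched_nbhd) compact_preimage:
  assumes fin: "finite sheets"
  obtains N K where "open N" "y \<in> N" "compact K" "K \<subseteq> X" "{x \<in> X. f x \<in> N} \<subseteq> K"
proof
  define N where "N = \<kappa> -` ball 0 (1/2) \<inter> V"
  define r where "r U = root (t U) (1/2)" for U
  have r: "0 \<le> r U" "r U < 1" "r U ^ t U = 1/2" if "U \<in> sheets" for U
    using t_pos[OF that] by (auto simp: r_def)
  define K where "K = (\<Union>U\<in>sheets. inv_into U (\<theta> U) ` cball 0 (r U))"
  show "open N"
    unfolding N_def using continuous_on_open_vimage[of V \<kappa>] disk_chartD[OF \<kappa>] by blast
  show "y \<in> N"
    using y_in \<kappa>_y by (simp add: N_def)
  show "compact K"
    unfolding K_def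
  proof (rule compact_UN[OF fin])
    fix U assume U: "U \<in> sheets"
    have "cball 0 (r U) \<subseteq> ball 0 1"
      using r[OF U] by auto
    then show "compact (inv_into U (\<theta> U) ` cball 0 (r U))"
      using continuous_on_subset[OF disk_chartD(5)[OF \<theta>[OF U]]]
      by (intro compact_continuous_image compact_cball)
  qed
  show "K \<subseteq> X"
  proof
    fix x assume "x \<in> K"
    then obtain U z where U: "U \<in> sheets" "norm z \<le> r U" "x = inv_into U (\<theta> U) z"
      unfolding K_def by auto
    then have "norm z < 1"
      using r[OF U(1)] by simp
    then have "x \<in> U"
      using disk_chart_inv(1)[OF \<theta>[OF U(1)]] U(3) by simp
    then show "x \<in> X"
      using sheet_subset[OF U(1)] by auto
  qed
  show "{x \<in> X. f x \<in> N} \<subseteq> K"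
  proof
    fix x assume x: "x \<in> {x \<in> X. f x \<in> N}"
    then obtain U where U: "U \<in> sheets" "x \<in> U"
      by (auto simp: N_def elim: sheetE)
    have "norm (\<theta> U x) ^ t U < r U ^ t U"
      using x \<kappa>_f[OF U] r[OF U(1)] by (simp add: N_def norm_power)
    then have "norm (\<theta> U x) < r U"
      using r[OF U(1)] power_less_imp_less_base by blast
    then have "x \<in> inv_into U (\<theta> U) ` cball 0 (r U)"
      using U(2) disk_chartD(2)[OF \<theta>[OF U(1)]]
      by (intro image_eqI[of _ _ "\<theta> U x"]) auto
    then show "x \<in> K"
      unfolding K_def using U(1) by (intro UN_I)
  qed
qed

lemma locally_proper:
  assumes cov: "branched_covering X Y f" and Y: "open Y" "connected (Fin -` Y)" "Fin -` Y \<noteq> {}"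
    and deg: "covering_degree X Y f < \<infinity>" and y: "y \<in> Y"
  obtains N K where "open N" "y \<in> N" "compact K" "K \<subseteq> X" "{x \<in> X. f x \<in> N} \<subseteq> K"
proof -
  obtain V \<kappa> \<theta> t where *: "branched_nbhd X f V y \<kappa> \<theta> t" "V \<subseteq> Y"
    by (rule branched_covering_nbhd[OF cov y])
  then interpret branched_nbhd X f V y \<kappa> \<theta> t by simp
  \<comment> \<open>The degree counts fibres over regular values only: \<open>v\<close> is
    \<open>y\<close> itself if that is regular, and otherwise the point with coordinate 1/2, which
    is not the centre.\<close>
  define v where "v = inv_into V \<kappa> (if y \<in> f ` branch_points X f then 1/2 else 0)"
  have v: "v \<in> V" "\<kappa> v = (if y \<in> f ` branch_points X f then 1/2 else 0)"
    unfolding v_def by (intro disk_chart_inv[OF \<kappa>]; simp)+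
  have v': "v \<notin> f ` branch_points X f"
  proof (cases "y \<in> f ` branch_points X f")
    case True
    then have "\<kappa> v \<noteq> \<kappa> y"
      unfolding v(2) \<kappa>_y by simp
    then show ?thesis
      using critical_value_eq[OF v(1)] by metis
  next
    case False
    then have "\<kappa> v = \<kappa> y"
      using v(2) \<kappa>_y by simp
    then show ?thesis
      using False \<kappa>_eq_iff[OF v(1) y_in] by simp
  qed
  have "v \<in> Y"
    using v(1) *(2) by auto
  then have "fibre_size X f v \<noteq> \<infinity>"
    using fibre_size_eq_covering_degree[OF cov Y _ v'] deg by simp
  then have "finite sheets"
    by (rule finite_sheets[OF v(1) v'])
  then show thesis
    by (rule compact_preimage) (rule that)
qed

text \<open>A finite subcover turns local properness into properness; containment in a compact
  subset of \<open>X\<close> is the form that keeps preimages away from the edge of the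
  surface.\<close>

lemma compact_preimage_compact:
  assumes cov: "branched_covering X Y f" and Y: "open Y" "connected (Fin -` Y)" "Fin -` Y \<noteq> {}"
    and deg: "covering_degree X Y f < \<infinity>" and K: "compact K" "K \<subseteq> Y"
  obtains L where "compact L" "L \<subseteq> X" "{x \<in> X. f x \<in> K} \<subseteq> L"
proof -
  have "\<exists>N L. open N \<and> y \<in> N \<and> compact L \<and> L \<subseteq> X \<and> {x \<in> X. f x \<in> N} \<subseteq> L" if "y \<in> K" for y
  proof -
    have "y \<in> Y"
      using that K(2) by auto
    then obtain N L where "open N" "y \<in> N" "compact L" "L \<subseteq> X" "{x \<in> X. f x \<in> N} \<subseteq> L"
      by (rule locally_proper[OF cov Y deg])
    then show ?thesis
      by (intro exI conjI)
  qed
  then obtain N L where NL: "\<And>y. y \<in> K \<Longrightarrow> open (N y) \<and> y \<in> N y \<and> compact (L y) \<and> L y \<subseteq> X \<and>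
      {x \<in> X. f x \<in> N y} \<subseteq> L y"
    by metis
  obtain D where D: "D \<subseteq> K" "finite D" "K \<subseteq> (\<Union>y\<in>D. N y)"
    using compactE_image[OF K(1), of K N] NL by blast
  show thesis
  proof
    show "compact (\<Union>y\<in>D. L y)"
      using D NL by (intro compact_UN) auto
    show "(\<Union>y\<in>D. L y) \<subseteq> X"
      using D NL by blast
    show "{x \<in> X. f x \<in> K} \<subseteq> (\<Union>y\<in>D. L y)"
      using D NL by blast
  qed
qed

section \<open>Radius bounds for compact sets in the plane and the disk\<close>

lemma compact_subset_Fin_ball:
  assumes "compact L" "L \<subseteq> range Fin"
  obtains R where "R > 0" "L \<subseteq> Fin ` ball 0 R"
proof -
  have "L \<subseteq> (\<Union>n\<in>UNIV. Fin ` ball 0 (real (Suc n)))"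
  proof
    fix p assume "p \<in> L"
    then obtain z where "p = Fin z"
      using assms(2) by auto
    moreover obtain n where "norm z < real n"
      using reals_Archimedean2 by blast
    ultimately show "p \<in> (\<Union>n\<in>UNIV. Fin ` ball 0 (real (Suc n)))"
      by (intro UN_I[of n] imageI) auto
  qed
  then obtain D where D: "finite D" "L \<subseteq> (\<Union>n\<in>D. Fin ` ball 0 (real (Suc n)))"
    by (rule compactE_image[OF assms(1), rotated]) (auto intro: open_image_Fin that)
  show thesis
  proof
    show "0 < real (Suc (Max D))"
      by simp
    show "L \<subseteq> Fin ` ball 0 (real (Suc (Max D)))"
    proof
      fix p assume "p \<in> L"
      then obtain n where n: "n \<in> D" "p \<in> Fin ` ball 0 (real (Suc n))"
        using D(2) by blast
      have "ball 0 (real (Suc n)) \<subseteq> (ball 0 (real (Suc (Max D))) :: complex set)"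
        using Max_ge[OF D(1) n(1)] by (intro subset_ball) simp
      then show "p \<in> Fin ` ball 0 (real (Suc (Max D)))"
        using n(2) by blast
    qed
  qed
qed

lemma compact_subset_open_disk:
  assumes "compact K" "K \<subseteq> ball 0 1"
  obtains r where "r < 1" "K \<subseteq> ball (0::complex) r"
proof (cases "K = {}")
  case True
  then show thesis
    using that[of 0] by simp
next
  case False
  obtain m where m: "m \<in> norm ` K" "\<And>x. x \<in> norm ` K \<Longrightarrow> x \<le> m"
    using compact_attains_sup[of "norm ` K"] False assms(1)
    by (auto intro!: compact_continuous_image continuous_intros)
  then have "m < 1"
    using assms(2) by auto
  then obtain r where "m < r" "r < 1"
    using dense by blast
  then show thesis
    using m(2) by (intro that[of r]) force+
qed

lemma compact_subset_unit_disk: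
  assumes "compact L" "L \<subseteq> unit_disk"
  obtains r where "r < 1" "L \<subseteq> Fin ` ball 0 r"
proof -
  have "compact (coord ` L)"
    using assms by (intro compact_continuous_image continuous_on_subset[OF continuous_on_coord])
      (auto simp: unit_disk_def)
  moreover have "coord ` L \<subseteq> ball 0 1"
    using assms(2) by (auto simp: unit_disk_def)
  ultimately obtain r where r: "r < 1" "coord ` L \<subseteq> ball 0 r"
    by (rule compact_subset_open_disk)
  have "L \<subseteq> Fin ` ball 0 r"
  proof
    fix p assume p: "p \<in> L"
    then obtain z where z: "p = Fin z"
      using assms(2) by (auto simp: unit_disk_def)
    then have "z \<in> coord ` L"
      using p by force
    then show "p \<in> Fin ` ball 0 r"
      using r(2) z by blast
  qed
  then show thesis
    using that r(1) by blast
qed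

section \<open>Preimages of unbranched disks\<close>

text \<open>Over an unbranched \<open>V\<close> every sheet has exponent 1, so small sets are evenly
  covered. The condition on \<open>Infinity\<close> keeps the whole preimage in the plane.\<close>

lemma unbranched_covering_space:
  assumes cov: "branched_covering X Y f" and V: "open V" "Fin ` V \<subseteq> Y"
    and unbranched: "Fin ` V \<inter> f ` branch_points X f = {}"
    and Inf: "Infinity \<in> X \<Longrightarrow> f Infinity \<notin> Fin ` V"
  shows "covering_space {z. Fin z \<in> X \<and> f (Fin z) \<in> Fin ` V} (\<lambda>z. coord (f (Fin z))) V"
    (is "covering_space ?C ?p V")
proof -
  have f_cont: "continuous_on X f" and f_im: "f ` X = Y"
    using cov by (auto simp: branched_covering_def sphere_holomorphic_on_def)
  have p: "Fin (?p z) = f (Fin z)" "?p z \<in> V" if "z \<in> ?C" for z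
    using that by auto
  have C: "\<exists>z\<in>?C. x = Fin z" if "x \<in> X" "f x \<in> Fin ` V" for x
    using that Inf by (cases x) auto
  have "continuous_on ?C (f \<circ> Fin)"
    by (rule continuous_on_compose[OF continuous_on_Fin]) (auto intro: continuous_on_subset[OF f_cont])
  then have "continuous_on ?C (coord \<circ> (f \<circ> Fin))"
    by (rule continuous_on_compose) (auto intro: continuous_on_subset[OF continuous_on_coord])
  then have p_cont: "continuous_on ?C ?p"
    by (simp add: o_def)
  have p_im: "?p ` ?C = V"
  proof
    show "V \<subseteq> ?p ` ?C"
    proof
      fix v assume v: "v \<in> V"
      then obtain x where x: "x \<in> X" "f x = Fin v"
        using V(2) f_im by (metis (no_types, lifting) image_iff subsetD)
      then obtain z where "z \<in> ?C" "x = Fin z"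
        using C[of x] v by auto
      then show "v \<in> ?p ` ?C"
        using x by (intro image_eqI[of _ _ z]) auto
    qed
  qed (use p in auto)
  have "\<exists>T. w \<in> T \<and> openin (top_of_set V) T \<and> (\<exists>v. \<Union> v = ?C \<inter> ?p -` T \<and>
      (\<forall>u\<in>v. openin (top_of_set ?C) u) \<and> pairwise disjnt v \<and> (\<forall>u\<in>v. \<exists>q. homeomorphism u T ?p q))"
    if w: "w \<in> V" for w
  proof -
    have "Fin w \<in> Y"
      using V(2) w by auto
    then obtain W \<kappa> \<theta> t where "branched_nbhd X f W (Fin w) \<kappa> \<theta> t"
      by (rule branched_covering_nbhd[OF cov])
    then interpret branched_nbhd X f W "Fin w" \<kappa> \<theta> t .
    have "Fin w \<notin> f ` branch_points X f"
      using unbranched w by blast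
    then have t1: "t U = 1" if "U \<in> sheets" for U
      using t_eq_1 that by blast
    define T where "T = V \<inter> Fin -` W"
    have "w \<in> T"
      using w y_in by (simp add: T_def)
    moreover have "openin (top_of_set V) T"
      unfolding T_def using disk_chartD(1)[OF \<kappa>] by (intro openin_open_Int open_vimage_Fin)
    moreover have "\<exists>v. \<Union> v = ?C \<inter> ?p -` T \<and> (\<forall>u\<in>v. openin (top_of_set ?C) u) \<and>
       pairwise disjnt v \<and> (\<forall>u\<in>v. \<exists>q. homeomorphism u T ?p q)"
    proof (rule exI, intro conjI ballI)
      let ?v = "(\<lambda>U. ?C \<inter> Fin -` U) ` sheets"
      show "\<Union> ?v = ?C \<inter> ?p -` T"
      proof (intro subset_antisym subsetI)
        fix z assume "z \<in> \<Union> ?v"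
        then obtain U where "U \<in> sheets" "z \<in> ?C" "Fin z \<in> U"
          by auto
        then show "z \<in> ?C \<inter> ?p -` T"
          using sheet_subset[of U] by (auto simp: T_def)
      next
        fix z assume z: "z \<in> ?C \<inter> ?p -` T"
        then have "Fin z \<in> X" "f (Fin z) \<in> W"
          by (auto simp: T_def)
        then obtain U where "U \<in> sheets" "Fin z \<in> U"
          by (rule sheetE)
        then show "z \<in> \<Union> ?v"
          using z by auto
      qed
      show "pairwise disjnt ?v"
      proof (rule pairwiseI)
        fix A B assume AB: "A \<in> ?v" "B \<in> ?v" "A \<noteq> B"
        then obtain U U' where U: "U \<in> sheets" "U' \<in> sheets" "A = ?C \<inter> Fin -` U" "B = ?C \<inter> Fin -` U'"
          by auto
        then have "U \<noteq> U'"
          using AB(3) by auto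
        then show "disjnt A B"
          using sheets_disjoint[OF U(1,2)] U(3,4) by (auto simp: disjnt_def)
      qed
      fix u assume "u \<in> ?v"
      then obtain U where U: "U \<in> sheets" and u: "u = ?C \<inter> Fin -` U"
        by auto
      show "openin (top_of_set ?C) u"
        unfolding u using disk_chartD(1)[OF \<theta>[OF U]] by (intro openin_open_Int open_vimage_Fin)
      \<comment> \<open>With exponent 1 the relation \<open>\<kappa> (f x) = \<theta> U x\<close>
        holds on the sheet, so the local inverse of \<open>f\<close> is \<open>\<kappa>\<close>
        followed by the inverse of \<open>\<theta> U\<close>.\<close>
      define s where "s v = inv_into U (\<theta> U) (\<kappa> (Fin v))" for v
      have s: "s v \<in> U" "f (s v) = Fin v" if "v \<in> T" for v
      proof -
        have W: "Fin v \<in> W"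
          using that by (simp add: T_def)
        have s': "s v \<in> U" "\<theta> U (s v) = \<kappa> (Fin v)"
          unfolding s_def using disk_chart_inv[OF \<theta>[OF U]] \<kappa>_norm[OF W] by auto
        then have "\<kappa> (f (s v)) = \<kappa> (Fin v)"
          using \<kappa>_f[OF U] t1[OF U] by simp
        moreover have "f (s v) \<in> W"
          using sheet_subset[OF U] s'(1) by auto
        ultimately show "s v \<in> U" "f (s v) = Fin v"
          using s'(1) \<kappa>_eq_iff W by auto
      qed
      have s_Fin: "\<exists>z\<in>u. s v = Fin z" if "v \<in> T" for v
      proof -
        have "s v \<in> X" "f (s v) \<in> Fin ` V"
          using s[OF that] sheet_subset[OF U] that by (auto simp: T_def)
        then obtain z where "z \<in> ?C" "s v = Fin z"
          using C by blast
        then show ?thesis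
          using s(1)[OF that] by (auto simp: u)
      qed
      have T_u: "?p z \<in> T" "s (?p z) = Fin z" if "z \<in> u" for z
      proof -
        have z: "z \<in> ?C" "Fin z \<in> U"
          using that by (auto simp: u)
        then show "?p z \<in> T"
          using p[OF z(1)] sheet_subset[OF U] by (auto simp: T_def)
        show "s (?p z) = Fin z"
          unfolding s_def p(1)[OF z(1)]
          using \<kappa>_f[OF U z(2)] t1[OF U] disk_chartD(2)[OF \<theta>[OF U]] z(2) by simp
      qed
      have "continuous_on T s"
      proof -
        have "continuous_on T (\<kappa> \<circ> Fin)"
          by (rule continuous_on_compose[OF continuous_on_Fin])
            (auto intro: continuous_on_subset[OF disk_chartD(4)[OF \<kappa>]] simp: T_def)
        then have "continuous_on T (inv_into U (\<theta> U) \<circ> (\<kappa> \<circ> Fin))"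
          by (rule continuous_on_compose)
            (auto intro!: continuous_on_subset[OF disk_chartD(5)[OF \<theta>[OF U]]] \<kappa>_norm simp: T_def)
        then show ?thesis
          by (simp add: o_def s_def[abs_def])
      qed
      then have "continuous_on T (coord \<circ> s)"
        using s_Fin by (intro continuous_on_compose continuous_on_subset[OF continuous_on_coord]) blast+
      then have "homeomorphism u T ?p (coord \<circ> s)"
      proof (intro homeomorphismI)
        show "continuous_on u ?p"
          by (rule continuous_on_subset[OF p_cont]) (simp add: u)
        show "(coord \<circ> s) ` T \<subseteq> u"
          using s_Fin by fastforce
        show "?p ((coord \<circ> s) v) = v" if "v \<in> T" for v
          using s_Fin[OF that] s(2)[OF that] by auto
      qed (use T_u in auto)
      then show "\<exists>q. homeomorphism u T ?p q"
        by blast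
    qed
    ultimately show ?thesis
      by (intro exI[of _ T] conjI)
  qed
  then show ?thesis
    by (intro covering_spaceI[OF p_cont p_im])
qed

lemma finite_fibre:
  assumes cov: "branched_covering X Y f" and Y: "open Y" "connected (Fin -` Y)"
    and deg: "covering_degree X Y f = enat d"
    and w: "Fin w \<in> Y" "Fin w \<notin> f ` branch_points X f" and Inf: "Infinity \<in> X \<Longrightarrow> f Infinity \<noteq> Fin w"
  shows "finite {z. Fin z \<in> X \<and> f (Fin z) = Fin w}" "card {z. Fin z \<in> X \<and> f (Fin z) = Fin w} = d"
proof -
  let ?F = "{z. Fin z \<in> X \<and> f (Fin z) = Fin w}"
  have "Fin -` Y \<noteq> {}"
    using w(1) by auto
  then have size: "fibre_size X f (Fin w) = enat d"
    using fibre_size_eq_covering_degree[OF cov Y _ w] deg by simp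
  have "x \<in> Fin ` ?F" if "x \<in> X" "f x = Fin w" for x
    using that Inf by (cases x) auto
  then have "{x \<in> X. f x = Fin w} = Fin ` ?F"
    by auto
  then show "finite ?F" "card ?F = d"
    using size by (auto simp: fibre_size_def finite_image_iff inj_on_def card_image split: if_splits)
qed

text \<open>Since \<open>V\<close> is simply connected, its identity map lifts through the covering
  from each of the \<open>d\<close> points over a base point \<open>w\<close>. The images of these
  lifts are the members of \<open>\<C>\<close>.\<close>

lemma simply_connected_preimages:
  assumes cov: "branched_covering X Y f" and Y: "open Y" "connected (Fin -` Y)"
    and deg: "covering_degree X Y f = enat d"
    and V: "open V" "simply_connected V" "V \<noteq> {}" "Fin ` V \<subseteq> Y"
    and unbranched: "Fin ` V \<inter> f ` branch_points X f = {}"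
    and Inf: "Infinity \<in> X \<Longrightarrow> f Infinity \<notin> Fin ` V"
  obtains \<C> where "finite \<C>" "card \<C> = d" "pairwise disjnt \<C>"
    "\<And>U. U \<in> \<C> \<Longrightarrow> open U \<and> simply_connected U \<and> U \<noteq> {} \<and> Fin ` U \<subseteq> X \<and>
       bij_betw f (Fin ` U) (Fin ` V)"
proof -
  let ?C = "{z. Fin z \<in> X \<and> f (Fin z) \<in> Fin ` V}" and ?p = "\<lambda>z. coord (f (Fin z))"
  have covsp: "covering_space ?C ?p V"
    by (rule unbranched_covering_space) fact+
  obtain w where w: "w \<in> V"
    using V(3) by blast
  define F where "F = {z \<in> ?C. ?p z = w}"
  have "\<forall>a\<in>F. \<exists>h. continuous_on V h \<and> h \<in> V \<rightarrow> ?C \<and> h w = a \<and> (\<forall>v\<in>V. ?p (h v) = v)"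
  proof
    fix a assume "a \<in> F"
    then have a: "a \<in> ?C" "w = ?p a"
      by (auto simp: F_def)
    obtain h where "continuous_on V h" "h \<in> V \<rightarrow> ?C" "h w = a" "\<And>v. v \<in> V \<Longrightarrow> ?p (h v) = v"
      by (rule covering_space_lift_strong[OF covsp a(1) w V(2) open_imp_locally_path_connected[OF V(1)]
            continuous_on_id _ a(2)]) auto
    then show "\<exists>h. continuous_on V h \<and> h \<in> V \<rightarrow> ?C \<and> h w = a \<and> (\<forall>v\<in>V. ?p (h v) = v)"
      by blast
  qed
  from bchoice[OF this] obtain h where "\<forall>a\<in>F. continuous_on V (h a) \<and> h a \<in> V \<rightarrow> ?C \<and>
      h a w = a \<and> (\<forall>v\<in>V. ?p (h a v) = v)" ..
  then have h: "continuous_on V (h a) \<and> h a \<in> V \<rightarrow> ?C \<and> h a w = a \<and> (\<forall>v\<in>V. ?p (h a v) = v)"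
    if "a \<in> F" for a
    using that by blast
  have disj: "a = b" if ab: "a \<in> F" "b \<in> F" "x \<in> h a ` V" "x \<in> h b ` V" for a b x
  proof -
    obtain v v' where v: "v \<in> V" "v' \<in> V" "h a v = h b v'"
      using ab(3,4) by auto
    then have "v = v'"
      using h[OF ab(1)] h[OF ab(2)] by metis
    \<comment> \<open>Lifts whose images meet agree at a point, because \<open>?p\<close> recovers
      the argument; uniqueness of lifts on the connected \<open>V\<close> then equates their
      starting points.\<close>
    have "h a w = h b w"
    proof (rule covering_space_lift_unique[OF covsp, of "h a" v "h b" V "\<lambda>z. z"])
      show "connected V"
        by (rule simply_connected_imp_connected) fact
    qed (use h[OF ab(1)] h[OF ab(2)] v w \<open>v = v'\<close> in auto)
    then show ?thesis
      using h[OF ab(1)] h[OF ab(2)] by simp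
  qed
  have "F = {z. Fin z \<in> X \<and> f (Fin z) = Fin w}"
    using w by (auto simp: F_def)
  moreover have "Fin w \<in> Y" "Fin w \<notin> f ` branch_points X f" "Infinity \<in> X \<Longrightarrow> f Infinity \<noteq> Fin w"
    using V(4) unbranched Inf w by auto
  ultimately have F: "finite F" "card F = d"
    using finite_fibre[OF cov Y deg] by simp_all
  show thesis
  proof
    let ?\<C> = "(\<lambda>a. h a ` V) ` F"
    show "finite ?\<C>"
      using F by simp
    have "inj_on (\<lambda>a. h a ` V) F"
    proof (rule inj_onI)
      fix a b assume ab: "a \<in> F" "b \<in> F" "h a ` V = h b ` V"
      show "a = b"
        by (rule disj[OF ab(1,2), of "h a w"]) (use w ab(3) in auto)
    qed
    then show "card ?\<C> = d"
      using F by (simp add: card_image)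
    show "pairwise disjnt ?\<C>"
    proof (rule pairwiseI)
      fix A B assume AB: "A \<in> ?\<C>" "B \<in> ?\<C>" "A \<noteq> B"
      then obtain a b where ab: "a \<in> F" "b \<in> F" "A = h a ` V" "B = h b ` V"
        by auto
      then have "a \<noteq> b"
        using AB(3) by auto
      then show "disjnt A B"
        using disj[OF ab(1,2)] by (auto simp: ab(3,4) disjnt_def)
    qed
    fix U assume "U \<in> ?\<C>"
    then obtain a where a: "a \<in> F" and U: "U = h a ` V"
      by auto
    have inj: "inj_on (h a) V"
      by (rule inj_on_inverseI[of V ?p]) (use h[OF a] in blast)
    have p_U: "continuous_on U ?p"
      using covering_space_imp_continuous[OF covsp] h[OF a] unfolding U
      by (auto intro: continuous_on_subset)
    have "homeomorphism V U (h a) ?p"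
      using h[OF a] p_U by (intro homeomorphismI) (auto simp: U)
    then have "simply_connected U"
      using V(2) homeomorphic_simply_connected_eq homeomorphic_def by blast
    moreover have "open U"
      unfolding U using h[OF a] V(1) inj by (intro invariance_of_domain) auto
    moreover have "Fin ` U \<subseteq> X"
      using h[OF a] by (auto simp: U)
    moreover have "f (Fin (h a v)) = Fin v" if "v \<in> V" for v
    proof -
      have "h a v \<in> ?C" "?p (h a v) = v"
        using h[OF a] that by blast+
      then show ?thesis
        by auto
    qed
    then have "bij_betw f (Fin ` U) (Fin ` V)"
      unfolding U by (intro bij_betwI[where g = "\<lambda>p. Fin (h a (coord p))"]) auto
    ultimately show "open U \<and> simply_connected U \<and> U \<noteq> {} \<and> Fin ` U \<subseteq> X \<and>
       bij_betw f (Fin ` U) (Fin ` V)"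
      using V(3) by (auto simp: U)
  qed
qed

section \<open>Rational functions and Blaschke products\<close>

text \<open>The pole is described by the reciprocal: near \<open>a\<close>, \<open>g\<close> is
  \<open>1 / v\<close> for a \<open>v\<close> with a simple zero. Differentiability of
  \<open>v\<close> at the single point \<open>a\<close> suffices for the limits taken, and the value
  \<open>g a\<close> is left free.\<close>

definition simple_pole_at :: "(complex \<Rightarrow> complex) \<Rightarrow> complex \<Rightarrow> bool" where
  "simple_pole_at g a \<longleftrightarrow> (\<exists>v v'. (v has_field_derivative v') (at a) \<and> v' \<noteq> 0 \<and> v a = 0 \<and>
     (\<forall>\<^sub>F z in at a. g z = inverse (v z)))"

text \<open>Near \<open>a\<close> the product is a quotient of two difference quotients and tends to
  \<open>deriv u a / v'\<close>. These limits fill in the removable singularities, with a nonzero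
  value where \<open>u\<close> has a simple zero.\<close>

lemma cancel_simple_poles:
  assumes S: "open S" and A: "finite A" "A \<subseteq> S"
    and u: "u holomorphic_on S" "\<And>a. a \<in> A \<Longrightarrow> u a = 0"
    and g: "g holomorphic_on S - A" "\<And>a. a \<in> A \<Longrightarrow> simple_pole_at g a"
  obtains q where "q holomorphic_on S" "\<And>z. z \<in> S - A \<Longrightarrow> q z = u z * g z"
    "\<And>a. a \<in> A \<Longrightarrow> deriv u a \<noteq> 0 \<Longrightarrow> q a \<noteq> 0"
proof -
  have "\<forall>a\<in>A. \<exists>l. ((\<lambda>z. u z * g z) \<longlongrightarrow> l) (at a) \<and> (deriv u a \<noteq> 0 \<longrightarrow> l \<noteq> 0)"
  proof
    fix a assume a: "a \<in> A"
    then obtain v v' where v: "(v has_field_derivative v') (at a)" "v' \<noteq> 0" "v a = 0"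
      and gv: "\<forall>\<^sub>F z in at a. g z = inverse (v z)"
      using g(2) unfolding simple_pole_at_def by blast
    have "(u has_field_derivative deriv u a) (at a)"
      using holomorphic_derivI[OF u(1) S] a A(2) by blast
    then have "((\<lambda>z. (u z - u a) / (z - a)) \<longlongrightarrow> deriv u a) (at a)"
      by (simp add: has_field_derivative_iff)
    moreover have "((\<lambda>z. (v z - v a) / (z - a)) \<longlongrightarrow> v') (at a)"
      using v(1) by (simp add: has_field_derivative_iff)
    ultimately have "((\<lambda>z. ((u z - u a) / (z - a)) / ((v z - v a) / (z - a))) \<longlongrightarrow> deriv u a / v') (at a)"
      by (rule tendsto_divide[OF _ _ v(2)])
    moreover have "\<forall>\<^sub>F z in at a. ((u z - u a) / (z - a)) / ((v z - v a) / (z - a)) = u z * g z"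
      using gv eventually_neq_at_within[of a]
    proof eventually_elim
      case (elim z)
      then show ?case
        using v(3) u(2)[OF a] by (simp add: divide_inverse)
    qed
    ultimately have "((\<lambda>z. u z * g z) \<longlongrightarrow> deriv u a / v') (at a)"
      by (rule Lim_transform_eventually)
    then show "\<exists>l. ((\<lambda>z. u z * g z) \<longlongrightarrow> l) (at a) \<and> (deriv u a \<noteq> 0 \<longrightarrow> l \<noteq> 0)"
      using v(2) by (intro exI[of _ "deriv u a / v'"]) simp
  qed
  from bchoice[OF this] obtain l where
    "\<forall>a\<in>A. ((\<lambda>z. u z * g z) \<longlongrightarrow> l a) (at a) \<and> (deriv u a \<noteq> 0 \<longrightarrow> l a \<noteq> 0)" ..
  then have l: "((\<lambda>z. u z * g z) \<longlongrightarrow> l a) (at a)" "deriv u a \<noteq> 0 \<Longrightarrow> l a \<noteq> 0" if "a \<in> A" for a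
    using that by auto
  define q where "q z = (if z \<in> A then l z else u z * g z)" for z
  show thesis
  proof
    show "q holomorphic_on S"
    proof (rule no_isolated_singularity'[OF _ _ S A(1)])
      have "(\<lambda>z. u z * g z) holomorphic_on S - A"
        using u(1) g(1) by (intro holomorphic_intros) (auto intro: holomorphic_on_subset)
      then show "q holomorphic_on S - A"
        by (rule holomorphic_transform) (auto simp: q_def)
      fix a assume a: "a \<in> A"
      have "\<forall>\<^sub>F z in at a. z \<notin> A"
        using islimpt_finite[OF A(1), of a] by (simp add: islimpt_iff_eventually)
      then have "\<forall>\<^sub>F z in at a. u z * g z = q z"
        by eventually_elim (simp add: q_def)
      with l(1)[OF a] have "(q \<longlongrightarrow> l a) (at a)"
        by (rule Lim_transform_eventually)
      then show "(q \<longlongrightarrow> q a) (at a within S)"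
        using a by (simp add: q_def Lim_at_imp_Lim_at_within)
    qed
    show "q z = u z * g z" if "z \<in> S - A" for z
      using that by (simp add: q_def)
    show "q a \<noteq> 0" if "a \<in> A" "deriv u a \<noteq> 0" for a
      using that l(2) by (simp add: q_def)
  qed
qed

section \<open>Polynomials with simple roots, rational functions and Wronskians\<close>

definition root_poly :: "complex set \<Rightarrow> complex poly" where
  "root_poly A = (\<Prod>a\<in>A. [:-a, 1:])"

lemma poly_root_poly: "poly (root_poly A) z = (\<Prod>a\<in>A. z - a)"
  by (simp add: root_poly_def poly_prod algebra_simps)

lemma poly_root_poly_eq_0: "finite A \<Longrightarrow> poly (root_poly A) z = 0 \<longleftrightarrow> z \<in> A"
  by (auto simp: poly_root_poly)

lemma degree_root_poly: "finite A \<Longrightarrow> degree (root_poly A) = card A"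
  unfolding root_poly_def by (subst degree_prod_sum_eq) auto

lemma pderiv_root_poly_nonzero:
  assumes "finite A" "a \<in> A"
  shows "poly (pderiv (root_poly A)) a \<noteq> 0"
proof -
  have "root_poly A = [:-a, 1:] * root_poly (A - {a})"
    unfolding root_poly_def using assms by (rule prod.remove)
  then have "poly (pderiv (root_poly A)) a = poly (root_poly (A - {a})) a"
    by (simp only: pderiv_mult poly_add poly_mult) (simp add: pderiv_pCons)
  then show ?thesis
    using assms(1) poly_root_poly_eq_0[of "A - {a}" a] by simp
qed

lemma deriv_poly_eq: "deriv (poly p) z = poly (pderiv p) z" for p :: "complex poly"
  by (rule DERIV_imp_deriv) (rule poly_DERIV)

text \<open>Multiplication by \<open>root_poly A\<close> clears the poles and leaves an entire
  function of growth at most \<open>norm z ^ card A\<close>, a polynomial by Liouville. It does not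
  vanish on \<open>A\<close>, so numerator and denominator share no root.\<close>

lemma rational_if_bounded_at_infinity:
  assumes A: "finite A" and g: "g holomorphic_on - A" "\<And>a. a \<in> A \<Longrightarrow> simple_pole_at g a"
    and bdd: "\<And>z. R \<le> norm z \<Longrightarrow> z \<notin> A \<Longrightarrow> norm (g z) \<le> B"
  obtains P where "degree P \<le> card A" "\<And>z. z \<notin> A \<Longrightarrow> g z = poly P z / poly (root_poly A) z"
    "\<And>a. a \<in> A \<Longrightarrow> poly P a \<noteq> 0"
proof -
  have "g holomorphic_on UNIV - A"
    using g(1) by (simp add: Compl_eq_Diff_UNIV)
  moreover have "poly (root_poly A) holomorphic_on UNIV"
    by (auto simp: holomorphic_on_def field_differentiable_def intro!: exI poly_DERIV)
  ultimately obtain q where q: "q holomorphic_on UNIV" "\<And>z. z \<notin> A \<Longrightarrow> q z = poly (root_poly A) z * g z"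
    "\<And>a. a \<in> A \<Longrightarrow> q a \<noteq> 0"
    using cancel_simple_poles[of UNIV A "poly (root_poly A)" g] A g(2) poly_root_poly_eq_0[OF A]
      pderiv_root_poly_nonzero[OF A]
    by (auto simp: deriv_poly_eq)
  \<comment> \<open>For \<open>norm z \<ge> M + 1\<close> the point \<open>z\<close> is outside
    \<open>A\<close> and every factor satisfies \<open>norm (z - a) \<le> 2 * norm z\<close>. The
    inserted 0 gives a maximum even for empty \<open>A\<close>.\<close>
  define M where "M = Max (insert 0 (norm ` A))"
  have M: "norm a \<le> M" if "a \<in> A" for a
    using A that by (auto simp: M_def)
  have growth: "norm (q z) \<le> (B * 2 ^ card A) * norm z ^ card A" if z: "max R (M + 1) \<le> norm z" for z
  proof -
    have "z \<notin> A"
      using M[of z] z by auto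
    then have "norm (g z) \<le> B"
      using bdd z by simp
    moreover have "norm (poly (root_poly A) z) \<le> (\<Prod>a\<in>A. 2 * norm z)"
      unfolding poly_root_poly prod_norm[symmetric]
    proof (rule prod_mono)
      fix a assume "a \<in> A"
      then have "norm (z - a) \<le> norm z + M"
        using norm_triangle_ineq4[of z a] M[of a] by linarith
      then show "0 \<le> norm (z - a) \<and> norm (z - a) \<le> 2 * norm z"
        using z by auto
    qed
    ultimately have "norm (poly (root_poly A) z) * norm (g z) \<le> (2 * norm z) ^ card A * B"
      by (intro mult_mono) auto
    then show ?thesis
      using q(2)[OF \<open>z \<notin> A\<close>] by (simp add: norm_mult power_mult_distrib mult_ac)
  qed
  define P where "P = (\<Sum>k\<le>card A. monom ((deriv ^^ k) q 0 / fact k) k)"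
  have P: "poly P z = q z" for z
    unfolding P_def poly_sum poly_monom
    using Liouville_polynomial[where A = "max R (M + 1)" and \<xi> = z, OF q(1) growth] by simp
  show thesis
  proof
    show "degree P \<le> card A"
      unfolding P_def by (intro degree_sum_le) (auto intro: order_trans[OF degree_monom_le])
    show "g z = poly P z / poly (root_poly A) z" if "z \<notin> A" for z
      using q(2)[OF that] poly_root_poly_eq_0[OF A, of z] that by (simp add: P)
    show "poly P a \<noteq> 0" if "a \<in> A" for a
      using q(3)[OF that] by (simp add: P)
  qed
qed

text \<open>The numerator of the derivative of \<open>P / Q\<close>, so its roots contain all
  critical points off the poles.\<close>

definition wronskian :: "complex poly \<Rightarrow> complex poly \<Rightarrow> complex poly" where
  "wronskian P Q = pderiv P * Q - P * pderiv Q"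

lemma card_wronskian_roots:
  assumes "degree P \<le> d" "degree Q \<le> d" "wronskian P Q \<noteq> 0"
  shows "finite {z. poly (wronskian P Q) z = 0}" "card {z. poly (wronskian P Q) z = 0} \<le> 2 * d"
proof -
  have "degree (wronskian P Q) \<le> 2 * d"
    unfolding wronskian_def using assms(1,2)
    by (intro degree_diff_le order_trans[OF degree_mult_le]) (auto simp: degree_pderiv)
  then show "card {z. poly (wronskian P Q) z = 0} \<le> 2 * d"
    using card_poly_roots_bound[OF assms(3)] by linarith
  show "finite {z. poly (wronskian P Q) z = 0}"
    by (rule poly_roots_finite) fact
qed

lemma wronskian_root:
  assumes "open N" "z \<in> N" and eq: "\<And>w. w \<in> N \<Longrightarrow> g w = poly P w / poly Q w" and Q: "poly Q z \<noteq> 0"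
    and "deriv g z = 0"
  shows "poly (wronskian P Q) z = 0"
proof -
  have "((\<lambda>w. poly P w / poly Q w) has_field_derivative
      (poly (pderiv P) z * poly Q z - poly P z * poly (pderiv Q) z) / (poly Q z * poly Q z)) (at z)"
    using Q by (intro DERIV_divide poly_DERIV)
  then have "(g has_field_derivative
      (poly (pderiv P) z * poly Q z - poly P z * poly (pderiv Q) z) / (poly Q z * poly Q z)) (at z)"
    by (rule has_field_derivative_transform_within_open[OF _ assms(1,2)]) (simp add: eq)
  then show ?thesis
    using assms(5) Q DERIV_imp_deriv by (force simp: wronskian_def)
qed

text \<open>No boundary values are available, so the maximum principle is applied on the circle of
  radius \<open>s\<close>, halfway between 1 and the larger of \<open>r\<close> and
  \<open>norm z\<close>: it encloses \<open>z\<close> and lies where the bound is assumed.\<close>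

lemma norm_le_in_disk:
  assumes "q holomorphic_on ball 0 1" "r < 1"
    and bdd: "\<And>z. r \<le> norm z \<Longrightarrow> norm z < 1 \<Longrightarrow> norm (q z) \<le> M" and z: "norm z < 1"
  shows "norm (q z) \<le> M"
proof -
  define s where "s = (max r (norm z) + 1) / 2"
  have s: "r \<le> s" "norm z < s" "s < 1"
    using assms(2) z by (auto simp: s_def field_simps max_def)
  have "0 < s"
    using s(2) norm_ge_zero[of z] by linarith
  show ?thesis
  proof (rule maximum_modulus_frontier[of q "ball 0 s"])
    show "q holomorphic_on interior (ball 0 s)"
      using assms(1) s by (auto intro: holomorphic_on_subset)
    have "continuous_on (cball 0 s) q"
      using holomorphic_on_imp_continuous_on[OF assms(1)] s(3) by (auto intro: continuous_on_subset)
    then show "continuous_on (closure (ball 0 s)) q"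
      using \<open>0 < s\<close> by simp
    show "norm (q w) \<le> M" if "w \<in> frontier (ball 0 s)" for w
      using that \<open>0 < s\<close> s by (intro bdd) auto
  qed (use s in auto)
qed

text \<open>On the circle \<open>1 = z * cnj z\<close>, so the denominator of a Blaschke factor is
  \<open>z\<close> times the conjugate of its numerator; finite Blaschke products therefore have
  modulus 1 there.\<close>

lemma norm_diff_eq_on_circle:
  assumes "norm z = 1"
  shows "norm (1 - cnj a * z) = norm (z - a)"
proof -
  have "z * cnj z = 1"
    using assms by (simp add: complex_norm_square[symmetric])
  then have "1 - cnj a * z = z * cnj (z - a)"
    by (simp add: algebra_simps)
  then show ?thesis
    using assms by (simp add: norm_mult del: complex_cnj_diff)
qed

text \<open>
  The quotient of \<open>h\<close> by the Blaschke product with the same zeros has modulus tending to 1 at the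
  circle; the maximum principle for it and for its reciprocal makes it constant.
\<close>

lemma blaschke_product:
  assumes A: "finite A" "A \<subseteq> ball 0 1" and h: "h holomorphic_on ball 0 1"
    and h1: "\<And>z. norm z < 1 \<Longrightarrow> norm (h z) < 1"
    and h0: "\<And>z. norm z < 1 \<Longrightarrow> h z = 0 \<longleftrightarrow> z \<in> A" and dh: "\<And>a. a \<in> A \<Longrightarrow> deriv h a \<noteq> 0"
    and proper: "\<And>\<rho>. 0 < \<rho> \<Longrightarrow> \<rho> < 1 \<Longrightarrow> \<exists>r<1. \<forall>z. r \<le> norm z \<longrightarrow> norm z < 1 \<longrightarrow> \<rho> \<le> norm (h z)"
  obtains c where "c \<noteq> 0"
    "\<And>z. norm z < 1 \<Longrightarrow> h z = poly (smult c (root_poly A)) z / poly (\<Prod>a\<in>A. [:1, - cnj a:]) z"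
    "\<And>z. norm z < 1 \<Longrightarrow> poly (\<Prod>a\<in>A. [:1, - cnj a:]) z \<noteq> 0"
proof -
  define Q where "Q = (\<Prod>a\<in>A. [:1, - cnj a:])"
  define B where "B z = poly (root_poly A) z / poly Q z" for z
  have poly_Q: "poly Q z = (\<Prod>a\<in>A. 1 - cnj a * z)" for z
    by (simp add: Q_def poly_prod algebra_simps)
  have Q0: "poly Q z \<noteq> 0" if "norm z \<le> 1" for z
  proof -
    have "cnj a * z \<noteq> 1" if "a \<in> A" for a
    proof -
      have "norm (cnj a * z) < 1"
      proof -
        have "norm (cnj a * z) \<le> norm a * 1"
          unfolding norm_mult complex_mod_cnj using \<open>norm z \<le> 1\<close> by (intro mult_left_mono) auto
        also have "\<dots> < 1"
          using A(2) \<open>a \<in> A\<close> by auto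
        finally show ?thesis .
      qed
      then show ?thesis
        by auto
    qed
    then show ?thesis
      using A(1) by (auto simp: poly_Q)
  qed
  have B_hol: "B holomorphic_on ball 0 1"
    unfolding B_def by (intro holomorphic_intros) (auto simp: Q0)
  have B_cont: "continuous_on (cball 0 1) B"
    unfolding B_def by (intro continuous_intros) (auto simp: Q0)
  have B_circle: "norm (B z) = 1" if "norm z = 1" for z
  proof -
    have "norm (poly (root_poly A) z) = norm (poly Q z)"
      unfolding poly_root_poly poly_Q prod_norm[symmetric]
      using that by (intro prod.cong) (simp_all add: norm_diff_eq_on_circle)
    then show ?thesis
      using Q0[of z] that by (simp add: B_def norm_divide)
  qed
  have B_le: "norm (B z) \<le> 1" if "norm z < 1" for z
    using maximum_modulus_frontier[of B "ball 0 1" 1 z] B_hol B_cont B_circle that by simp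
  have B0: "B z = 0 \<longleftrightarrow> z \<in> A" if "norm z < 1" for z
    using that Q0[of z] poly_root_poly_eq_0[OF A(1)] by (simp add: B_def)
  \<comment> \<open>\<open>B\<close> has modulus 1 on the circle, so the points of the closed disk
    where its modulus is at most \<open>\<rho>\<close> form a compact subset of the open
    disk.\<close>
  have B_proper: "\<exists>r<1. \<forall>z. r \<le> norm z \<longrightarrow> norm z < 1 \<longrightarrow> \<rho> \<le> norm (B z)"
    if \<rho>: "\<rho> < 1" for \<rho>
  proof -
    let ?K = "{z \<in> cball 0 1. norm (B z) \<le> \<rho>}"
    have "closed ?K"
      using B_cont by (intro continuous_on_closed_Collect_le continuous_intros) auto
    then have "compact ?K"
      by (auto simp: compact_eq_bounded_closed intro: bounded_subset[of "cball 0 1"])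
    moreover have "?K \<subseteq> ball 0 1"
    proof
      fix z assume z: "z \<in> ?K"
      then have "norm z \<noteq> 1"
        using B_circle[of z] \<rho> by auto
      then show "z \<in> ball 0 1"
        using z by simp
    qed
    ultimately obtain r where "r < 1" "?K \<subseteq> ball 0 r"
      by (rule compact_subset_open_disk)
    moreover have "\<rho> \<le> norm (B z)" if "r \<le> norm z" "norm z < 1" for z
    proof (rule ccontr)
      assume "\<not> \<rho> \<le> norm (B z)"
      then have "z \<in> ?K"
        using that by auto
      then show False
        using \<open>?K \<subseteq> ball 0 r\<close> that(1) by auto
    qed
    ultimately show ?thesis
      by blast
  qed
  have "simple_pole_at (\<lambda>z. inverse (B z)) a" if a: "a \<in> A" for a
    unfolding simple_pole_at_def
  proof (intro exI conjI)
    let ?D = "(poly (pderiv (root_poly A)) a * poly Q a - poly (root_poly A) a * poly (pderiv Q) a)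
      / (poly Q a * poly Q a)"
    have Qa: "poly Q a \<noteq> 0"
      using A(2) a by (intro Q0) auto
    show "(B has_field_derivative ?D) (at a)"
      unfolding B_def by (intro DERIV_divide poly_DERIV Qa)
    show "?D \<noteq> 0"
      using Qa pderiv_root_poly_nonzero[OF A(1) a] poly_root_poly_eq_0[OF A(1), of a] a by simp
    show "B a = 0"
      using a A(2) B0[of a] by auto
  qed simp
  moreover have "(\<lambda>z. inverse (B z)) holomorphic_on ball 0 1 - A"
    using B_hol B0 by (intro holomorphic_intros) (auto intro: holomorphic_on_subset)
  moreover have "h a = 0" if "a \<in> A" for a
    using that A(2) h0[of a] by auto
  \<comment> \<open>\<open>h\<close> and \<open>B\<close> have simple zeros exactly on
    \<open>A\<close>, so \<open>q\<close>, the extension of \<open>h / B\<close>, has neither zeros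
    nor poles.\<close>
  ultimately obtain q where q: "q holomorphic_on ball 0 1"
    "\<And>z. z \<in> ball 0 1 - A \<Longrightarrow> q z = h z * inverse (B z)" "\<And>a. a \<in> A \<Longrightarrow> q a \<noteq> 0"
    using cancel_simple_poles[of "ball 0 1" A h "\<lambda>z. inverse (B z)"] A h dh by auto
  have q0: "q z \<noteq> 0" if "norm z < 1" for z
    using that q(2)[of z] q(3)[of z] h0[of z] B0[of z] by (cases "z \<in> A") auto
  have hqB: "h z = q z * B z" if "norm z < 1" for z
    using that q(2)[of z] h0[of z] B0[of z] by (cases "z \<in> A") auto
  \<comment> \<open>Near the circle \<open>h\<close> and \<open>B\<close> have modulus between
    \<open>\<rho>\<close> and 1, which bounds \<open>q\<close> and its reciprocal by
    \<open>1 / \<rho>\<close> there and then inside. Letting \<open>\<rho>\<close> tend to 1 gives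
    modulus 1.\<close>
  have bounds: "norm (q z) \<le> 1 / \<rho> \<and> norm (inverse (q z)) \<le> 1 / \<rho>"
    if \<rho>: "0 < \<rho>" "\<rho> < 1" and z: "norm z < 1" for \<rho> z
  proof -
    obtain r1 r2 where r: "r1 < 1" "r2 < 1"
      and r1: "\<And>z. r1 \<le> norm z \<Longrightarrow> norm z < 1 \<Longrightarrow> \<rho> \<le> norm (h z)"
      and r2: "\<And>z. r2 \<le> norm z \<Longrightarrow> norm z < 1 \<Longrightarrow> \<rho> \<le> norm (B z)"
      using proper[OF \<rho>] B_proper[OF \<rho>(2)] by metis
    have *: "norm (q w) \<le> 1 / \<rho> \<and> norm (inverse (q w)) \<le> 1 / \<rho>"
      if w: "max r1 r2 \<le> norm w" "norm w < 1" for w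
    proof -
      have hw: "norm (h w) = norm (q w) * norm (B w)"
        using hqB[OF w(2)] by (simp add: norm_mult)
      have le: "\<rho> \<le> norm (h w)" "\<rho> \<le> norm (B w)" "norm (h w) \<le> 1" "norm (B w) \<le> 1"
        using r1[of w] r2[of w] w h1[of w] B_le[of w] by auto
      have q_pos: "0 < norm (q w)"
        using q0[OF w(2)] by simp
      have "norm (q w) * \<rho> \<le> norm (q w) * norm (B w)"
        using le(2) by (intro mult_left_mono) auto
      then have up: "norm (q w) * \<rho> \<le> 1"
        using hw le(3) by linarith
      have "norm (q w) * norm (B w) \<le> norm (q w) * 1"
        using le(4) by (intro mult_left_mono) auto
      then have low: "\<rho> \<le> norm (q w)"
        using hw le(1) by linarith
      have "norm (q w) \<le> 1 / \<rho>"
        using up \<rho>(1) by (simp add: pos_le_divide_eq)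
      moreover have "inverse (norm (q w)) \<le> 1 / \<rho>"
        unfolding inverse_eq_divide using low \<rho>(1) q_pos by (intro frac_le) auto
      ultimately show ?thesis
        by (simp only: norm_inverse)
    qed
    have "norm (q z) \<le> 1 / \<rho>"
      by (rule norm_le_in_disk[OF q(1), of "max r1 r2"]) (use r * z in auto)
    moreover have "(\<lambda>z. inverse (q z)) holomorphic_on ball 0 1"
      using q(1) q0 by (intro holomorphic_intros) auto
    then have "norm (inverse (q z)) \<le> 1 / \<rho>"
      by (rule norm_le_in_disk[of _ "max r1 r2"]) (use r * z in auto)
    ultimately show ?thesis
      by simp
  qed
  have norm_q: "norm (q z) = 1" if z: "norm z < 1" for z
  proof (rule antisym)
    have *: "\<rho> * norm (q z) \<le> 1 \<and> \<rho> \<le> norm (q z)" if "0 < \<rho>" "\<rho> < 1" for \<rho>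
    proof -
      have "norm (q z) * \<rho> \<le> 1"
        using bounds[OF that z] that by (simp add: pos_le_divide_eq)
      moreover have "inverse (norm (q z)) \<le> inverse \<rho>"
        using bounds[OF that z] by (simp add: norm_inverse inverse_eq_divide norm_divide)
      then have "\<rho> \<le> norm (q z)"
        by (rule inverse_le_imp_le) (use q0[OF z] in simp)
      ultimately show ?thesis
        by (simp add: mult.commute)
    qed
    show "norm (q z) \<le> 1"
    proof (rule field_le_mult_one_interval)
      show "\<rho> * norm (q z) \<le> 1" if "0 < \<rho>" "\<rho> < 1" for \<rho>
        using *[OF that] by simp
    qed
    show "1 \<le> norm (q z)"
    proof (rule field_le_mult_one_interval)
      show "\<rho> * 1 \<le> norm (q z)" if "0 < \<rho>" "\<rho> < 1" for \<rho>
        using *[OF that] by simp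
    qed
  qed
  have "q constant_on ball 0 1"
    by (rule maximum_modulus_principle[OF q(1), of "ball 0 1" 0]) (auto simp: norm_q)
  then obtain c where c: "\<And>z. norm z < 1 \<Longrightarrow> q z = c"
    by (auto simp: constant_on_def)
  show thesis
  proof (rule that[of c, folded Q_def])
    show "c \<noteq> 0"
      using c[of 0] q0[of 0] by simp
    show "h z = poly (smult c (root_poly A)) z / poly Q z" if "norm z < 1" for z
      using hqB[OF that] c[OF that] by (simp add: B_def)
  qed (simp add: Q0)
qed

section \<open>Counting branch points\<close>

lemma open_Fin_preimage:
  assumes "sphere_holomorphic_on f X" "open N"
  shows "open {z. Fin z \<in> X \<and> f (Fin z) \<in> N}"
proof -
  have "open (f -` N \<inter> X)"
    using assms continuous_on_open_vimage unfolding sphere_holomorphic_on_def by blast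
  then have "open (Fin -` (f -` N \<inter> X))"
    by (rule open_vimage_Fin)
  then show ?thesis
    by (simp add: vimage_def Collect_conj_eq Int_commute)
qed

lemma sphere_holomorphic_on_coord:
  assumes "sphere_holomorphic_on f X"
  shows "(\<lambda>z. coord (f (Fin z))) holomorphic_on {z. Fin z \<in> X \<and> f (Fin z) \<noteq> Infinity}"
    and "(\<lambda>z. coord (sphere_inverse (f (Fin z)))) holomorphic_on
      {z. Fin z \<in> X \<and> sphere_inverse (f (Fin z)) \<noteq> Infinity}"
  using assms unfolding sphere_holomorphic_on_def by fastforce+

text \<open>\<open>g\<close> depends only on the value of \<open>f\<close>, so local injectivity of
  \<open>g\<close> would pass to \<open>f\<close>.\<close>

lemma deriv_at_branch_point:
  assumes z: "Fin z \<in> branch_points X f" and N: "open N" "z \<in> N" "Fin ` N \<subseteq> X"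
    and g: "g holomorphic_on N" "\<And>a b. a \<in> N \<Longrightarrow> b \<in> N \<Longrightarrow> f (Fin a) = f (Fin b) \<Longrightarrow> g a = g b"
  shows "deriv g z = 0"
proof (rule ccontr)
  assume "deriv g z \<noteq> 0"
  then obtain r where r: "r > 0" "ball z r \<subseteq> N" "inj_on g (ball z r)"
    using has_complex_derivative_locally_injective[OF g(1) N(2,1)] by blast
  have "inj_on f (Fin ` ball z r)"
    using r(2,3) g(2) by (auto simp: inj_on_def subset_iff)
  moreover have "open (Fin ` ball z r)" "Fin z \<in> Fin ` ball z r" "Fin ` ball z r \<subseteq> X"
    using r N(3) by (auto intro: open_image_Fin)
  ultimately show False
    using z unfolding branch_points_def by blast
qed

text \<open>Here \<open>g\<close> determines the value of \<open>f\<close>, so local injectivity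
  passes from \<open>f\<close> to \<open>g\<close>, and an injective holomorphic function has
  nonvanishing derivative.\<close>

lemma deriv_off_branch_points:
  assumes z: "Fin z \<notin> branch_points X f" and N: "open N" "z \<in> N" "Fin ` N \<subseteq> X"
    and g: "g holomorphic_on N" "\<And>a b. a \<in> N \<Longrightarrow> b \<in> N \<Longrightarrow> g a = g b \<Longrightarrow> f (Fin a) = f (Fin b)"
  shows "deriv g z \<noteq> 0"
proof -
  have "Fin z \<in> X"
    using N(2,3) by auto
  then obtain M where M: "open M" "Fin z \<in> M" "inj_on f M"
    using z by (auto simp: branch_points_def)
  show ?thesis
  proof (rule holomorphic_injective_imp_regular)
    show "g holomorphic_on N \<inter> Fin -` M"
      using g(1) by (rule holomorphic_on_subset) auto
    show "open (N \<inter> Fin -` M)"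
      using N(1) M(1) by (intro open_Int open_vimage_Fin)
    show "inj_on g (N \<inter> Fin -` M)"
    proof (rule inj_onI)
      fix a b assume ab: "a \<in> N \<inter> Fin -` M" "b \<in> N \<inter> Fin -` M" "g a = g b"
      then have "f (Fin a) = f (Fin b)"
        using g(2) by auto
      then show "a = b"
        using inj_onD[OF M(3), of "Fin a" "Fin b"] ab by auto
    qed
  qed (use N(2) M(2) in auto)
qed

text \<open>Countably many values are forbidden and an open plane set is uncountable. Avoiding
  \<open>f Infinity\<close> as well keeps the whole fibre in the plane.\<close>

lemma exists_regular_value:
  assumes cov: "branched_covering X Y f" and Y: "open Y" "Fin -` Y \<noteq> {}"
  obtains w where "Fin w \<in> Y" "Fin w \<notin> f ` branch_points X f" "f Infinity \<noteq> Fin w"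
proof -
  obtain a r where ar: "r > 0" "ball a r \<subseteq> Fin -` Y"
    using open_vimage_Fin[OF Y(1)] Y(2) by (meson ex_in_conv open_contains_ball)
  \<comment> \<open>If \<open>f Infinity = Infinity\<close>, the inserted number is the dummy
    coordinate 0 and merely excludes one more value.\<close>
  have "countable (insert (coord (f Infinity)) {z. Fin z \<in> f ` branch_points X f})"
    using countable_critical_values[OF cov Y(1)] by simp
  then obtain w where "w \<in> ball a r"
    "w \<notin> insert (coord (f Infinity)) {z. Fin z \<in> f ` branch_points X f}"
    using uncountable_ball[OF ar(1), of a] by (meson countable_subset subsetI)
  moreover from this have "f Infinity \<noteq> Fin w"
    by auto
  ultimately show thesis
    using that[of w] ar(2) by auto
qed

text \<open>
  Choosing the pole of \<open>1 / (f - w)\<close> at a regular value \<open>w\<close> makes all its poles simple, so that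
  their number is the degree even though the degree ignores multiplicities.
\<close>

lemma finite_branch_points_rational:
  assumes cov: "branched_covering X Y f" and X: "range Fin \<subseteq> X" and Y: "open Y" "connected (Fin -` Y)"
    and deg: "covering_degree X Y f = enat d" and d: "1 \<le> d"
    and w: "Fin w \<in> Y" "Fin w \<notin> f ` branch_points X f" "f Infinity \<noteq> Fin w"
    and away: "e > 0" "\<And>z. R \<le> norm z \<Longrightarrow> f (Fin z) \<notin> Fin ` ball w e"
  shows "finite {z. Fin z \<in> branch_points X f} \<and> card {z. Fin z \<in> branch_points X f} \<le> 2 * d"
proof -
  have hol: "sphere_holomorphic_on f X"
    using cov by (simp add: branched_covering_def)
  define k where "k z = coord (f (Fin z))" for z
  define k' where "k' z = coord (sphere_inverse (f (Fin z)))" for z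
  \<comment> \<open>\<open>D\<close> and \<open>D'\<close> cover the plane: on them \<open>f\<close>
    is read as \<open>k\<close> and as its reciprocal \<open>k'\<close>, which is 0 at the poles of
    \<open>f\<close>.\<close>
  define D where "D = {z. f (Fin z) \<noteq> Infinity}"
  define D' where "D' = {z. sphere_inverse (f (Fin z)) \<noteq> Infinity}"
  define A where "A = {z. f (Fin z) = Fin w}"
  have in_X [simp]: "Fin z \<in> X" for z
    using X by auto
  have A: "finite A" "card A = d"
    using finite_fibre[OF cov Y deg w(1,2)] w(3) by (simp_all add: A_def)
  have k: "k holomorphic_on D" and k': "k' holomorphic_on D'"
    using sphere_holomorphic_on_coord[OF hol] by (simp_all add: k_def[abs_def] k'_def[abs_def] D_def D'_def)
  have not_Inf: "p \<noteq> Infinity \<longleftrightarrow> p \<in> range Fin" for p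
    by (cases p) auto
  have D: "open D" "open D'"
    using open_Fin_preimage[OF hol open_image_Fin[OF open_UNIV]]
      open_Fin_preimage[OF hol open_vimage_sphere_inverse[OF open_image_Fin[OF open_UNIV]]]
    by (simp_all add: D_def D'_def not_Inf)
  \<comment> \<open>This is \<open>1 / (f - w)\<close> with value 0 at the poles of
    \<open>f\<close>; in the reciprocal chart it reads \<open>k' / (1 - w * k')\<close>, which shows
    it holomorphic there.\<close>
  define g where "g z = (case f (Fin z) of Fin u \<Rightarrow> inverse (u - w) | Infinity \<Rightarrow> 0)" for z
  have gD: "g z = inverse (k z - w)" if "z \<in> D" for z
    using that by (cases "f (Fin z)") (auto simp: D_def k_def g_def)
  have AD: "z \<in> A \<longleftrightarrow> k z = w" if "z \<in> D" for z
    using that by (cases "f (Fin z)") (auto simp: D_def k_def A_def)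
  have gD': "g z = k' z / (1 - w * k' z)" "1 - w * k' z \<noteq> 0" if "z \<in> D' - A" for z
    using that by (cases "f (Fin z)"; auto simp: D'_def k'_def g_def A_def field_simps split: if_splits)+
  have "g holomorphic_on (D - A) \<union> (D' - A)"
  proof (rule holomorphic_on_Un)
    have "(\<lambda>z. inverse (k z - w)) holomorphic_on D - A"
      using AD holomorphic_on_subset[OF k, of "D - A"] by (intro holomorphic_intros) auto
    then show "g holomorphic_on D - A"
      by (rule holomorphic_transform) (simp add: gD)
    have "(\<lambda>z. k' z / (1 - w * k' z)) holomorphic_on D' - A"
      using gD' holomorphic_on_subset[OF k', of "D' - A"] by (intro holomorphic_intros) auto
    then show "g holomorphic_on D' - A"
      by (rule holomorphic_transform) (simp add: gD')
    show "open (D - A)" "open (D' - A)"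
      using D A(1) by (auto intro!: open_Diff finite_imp_closed)
  qed
  moreover have "(D - A) \<union> (D' - A) = - A"
  proof -
    have "z \<in> D \<union> D'" for z
      by (cases "f (Fin z)") (auto simp: D_def D'_def)
    then show ?thesis
      by blast
  qed
  ultimately have g_hol: "g holomorphic_on - A"
    by simp
  have pole: "simple_pole_at g a" if a: "a \<in> A" for a
    unfolding simple_pole_at_def
  proof (intro exI conjI)
    have aD: "a \<in> D"
      using a by (simp add: A_def D_def)
    show "((\<lambda>z. k z - w) has_field_derivative deriv k a) (at a)"
      using holomorphic_derivI[OF k D(1) aD] by (auto intro!: derivative_eq_intros)
    show "deriv k a \<noteq> 0"
    proof (rule deriv_off_branch_points[OF _ D(1) aD _ k])
      show "Fin a \<notin> branch_points X f"
        using a w(2) by (force simp: A_def)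
      show "f (Fin x) = f (Fin y)" if "x \<in> D" "y \<in> D" "k x = k y" for x y
        using that by (cases "f (Fin x)"; cases "f (Fin y)") (auto simp: D_def k_def)
    qed auto
    show "k a - w = 0"
      using a AD[OF aD] by simp
    show "\<forall>\<^sub>F z in at a. g z = inverse (k z - w)"
      using D(1) aD gD by (auto simp: eventually_at_topological)
  qed
  have bdd: "norm (g z) \<le> 1 / e" if z: "R \<le> norm z" "z \<notin> A" for z
  proof (cases "f (Fin z)")
    case (Fin u)
    then have "e \<le> norm (u - w)"
      using away(2)[OF z(1)] by (force simp: dist_norm norm_minus_commute)
    then show ?thesis
      using away(1) Fin by (auto simp: g_def norm_inverse inverse_eq_divide norm_divide intro!: frac_le)
  qed (use away(1) in \<open>simp add: g_def\<close>)
  obtain P where P: "degree P \<le> d" "\<And>z. z \<notin> A \<Longrightarrow> g z = poly P z / poly (root_poly A) z"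
    "\<And>a. a \<in> A \<Longrightarrow> poly P a \<noteq> 0"
    using rational_if_bounded_at_infinity[OF A(1) g_hol pole bdd] A(2) by metis
  let ?W = "wronskian P (root_poly A)"
  obtain a where "a \<in> A"
    using A d by (metis card.empty ex_in_conv not_one_le_zero)
  \<comment> \<open>At a root \<open>a\<close> of the denominator only the product of
    \<open>P\<close> with the derivative of \<open>root_poly A\<close> remains, and both factors are
    nonzero.\<close>
  then have "poly ?W a \<noteq> 0"
    using P(3) poly_root_poly_eq_0[OF A(1), of a] pderiv_root_poly_nonzero[OF A(1)]
    by (simp add: wronskian_def)
  then have W: "?W \<noteq> 0"
    by auto
  have "{z. Fin z \<in> branch_points X f} \<subseteq> {z. poly ?W z = 0}"
  proof
    fix z assume z: "z \<in> {z. Fin z \<in> branch_points X f}"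
    then have zA: "z \<in> - A"
      using w(2) by (force simp: A_def)
    have opn: "open (- A)"
      using A(1) by (auto intro: finite_imp_closed)
    have "deriv g z = 0"
      by (rule deriv_at_branch_point[OF _ opn zA _ g_hol]) (use z in \<open>auto simp: g_def\<close>)
    then show "z \<in> {z. poly ?W z = 0}"
      using wronskian_root[OF opn zA, of g P "root_poly A"] P(2) poly_root_poly_eq_0[OF A(1), of z] zA
      by auto
  qed
  moreover have "degree (root_poly A) \<le> d"
    using degree_root_poly[OF A(1)] A(2) by simp
  note card_wronskian_roots[OF P(1) this W]
  ultimately show ?thesis
    by (meson card_mono finite_subset order_trans)
qed

text \<open>A Moebius map takes the regular value \<open>w\<close> to 0, and properness makes the
  resulting disk map a Blaschke product with simple zeros on the fibre. Numerator and denominator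
  have degree at most \<open>d\<close>, so the Wronskian count applies again.\<close>

lemma finite_branch_points_disk:
  assumes cov: "branched_covering unit_disk unit_disk f"
    and deg: "covering_degree unit_disk unit_disk f = enat d" and d: "1 \<le> d"
    and w: "Fin w \<in> unit_disk" "Fin w \<notin> f ` branch_points unit_disk f" "f Infinity \<noteq> Fin w"
  shows "finite {z. Fin z \<in> branch_points unit_disk f} \<and>
    card {z. Fin z \<in> branch_points unit_disk f} \<le> 2 * d"
proof -
  have hol: "sphere_holomorphic_on f unit_disk" and f_im: "f ` unit_disk = unit_disk"
    using cov by (simp_all add: branched_covering_def)
  have in_disk: "Fin z \<in> unit_disk \<longleftrightarrow> norm z < 1" for z
    by (auto simp: unit_disk_def)
  have Y: "open unit_disk" "connected (Fin -` unit_disk)" "Fin -` unit_disk \<noteq> {}"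
  proof -
    have "Fin -` unit_disk = ball 0 1"
      by (auto simp: unit_disk_def)
    then show "connected (Fin -` unit_disk)" "Fin -` unit_disk \<noteq> {}"
      by auto
  qed (simp add: unit_disk_def open_image_Fin)
  define k where "k z = coord (f (Fin z))" for z
  have fk: "f (Fin z) = Fin (k z)" "norm (k z) < 1" if "norm z < 1" for z
  proof -
    have "f (Fin z) \<in> unit_disk"
      using f_im in_disk that by blast
    then show "f (Fin z) = Fin (k z)" "norm (k z) < 1"
      by (auto simp: unit_disk_def k_def)
  qed
  define A where "A = {z. Fin z \<in> unit_disk \<and> f (Fin z) = Fin w}"
  have A: "finite A" "card A = d"
    using finite_fibre[OF cov Y(1,2) deg w(1,2)] w(3) by (simp_all add: A_def)
  have A_sub: "A \<subseteq> ball 0 1"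
    by (auto simp: A_def in_disk)
  have w1: "norm w < 1"
    using w(1) in_disk by simp
  have "{z. Fin z \<in> unit_disk \<and> f (Fin z) \<noteq> Infinity} = ball 0 1"
    using fk(1) by (auto simp: in_disk)
  then have k_hol: "k holomorphic_on ball 0 1"
    using sphere_holomorphic_on_coord(1)[OF hol] by (simp add: k_def[abs_def])
  define h where "h = Moebius_function 0 w \<circ> k"
  have h_hol: "h holomorphic_on ball 0 1"
    unfolding h_def using fk(2)
    by (intro holomorphic_on_compose_gen[OF k_hol Moebius_function_holomorphic[OF w1]]) auto
  have h1: "norm (h z) < 1" if "norm z < 1" for z
    using Moebius_function_norm_lt_1[OF w1 fk(2)[OF that]] by (simp add: h_def)
  have h_inv: "Moebius_function 0 (- w) (h z) = k z" if "norm z < 1" for z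
    using Moebius_function_compose[of "- w" w "k z"] w1 fk(2)[OF that] by (simp add: h_def)
  have h0: "h z = 0 \<longleftrightarrow> z \<in> A" if "norm z < 1" for z
  proof
    assume "h z = 0"
    then have "k z = w"
      using h_inv[OF that] by (simp add: Moebius_function_of_zero)
    then show "z \<in> A"
      using fk(1)[OF that] that by (simp add: A_def in_disk)
  next
    assume "z \<in> A"
    then have "k z = w"
      by (simp add: A_def k_def)
    then show "h z = 0"
      by (simp add: h_def Moebius_function_eq_zero)
  qed
  have dh: "deriv h a \<noteq> 0" if a: "a \<in> A" for a
  proof (rule deriv_off_branch_points[of a unit_disk f "ball 0 1"])
    show "Fin a \<notin> branch_points unit_disk f"
      using a w(2) by (force simp: A_def)
    show "f (Fin x) = f (Fin y)" if "x \<in> ball 0 1" "y \<in> ball 0 1" "h x = h y" for x y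
      using h_inv[of x] h_inv[of y] that fk(1) by simp
  qed (use a A_sub h_hol in \<open>auto simp: in_disk\<close>)
  have proper: "\<exists>r<1. \<forall>z. r \<le> norm z \<longrightarrow> norm z < 1 \<longrightarrow> \<rho> \<le> norm (h z)" if \<rho>: "\<rho> < 1" for \<rho>
  proof -
    \<comment> \<open>The values of \<open>f\<close> at which \<open>h\<close> has modulus at most
      \<open>\<rho>\<close>; properness confines their preimage to a smaller disk.\<close>
    let ?K = "Fin ` Moebius_function 0 (- w) ` cball 0 \<rho>"
    have "cball 0 \<rho> \<subseteq> ball (0::complex) 1"
      using \<rho> by auto
    then have "continuous_on (cball 0 \<rho>) (Moebius_function 0 (- w))"
      using Moebius_function_holomorphic[of "- w" 0] w1
      by (auto intro: continuous_on_subset[OF holomorphic_on_imp_continuous_on])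
    then have K: "compact ?K"
      by (intro compact_continuous_image continuous_on_Fin compact_cball)
    have "?K \<subseteq> unit_disk"
      using Moebius_function_norm_lt_1[of "- w"] w1 \<rho> by (auto simp: in_disk)
    moreover have "covering_degree unit_disk unit_disk f < \<infinity>"
      by (simp add: deg)
    ultimately obtain L where L: "compact L" "L \<subseteq> unit_disk" "{x \<in> unit_disk. f x \<in> ?K} \<subseteq> L"
      using compact_preimage_compact[OF cov Y _ K] by metis
    obtain r where r: "r < 1" "L \<subseteq> Fin ` ball 0 r"
      by (rule compact_subset_unit_disk[OF L(1,2)])
    have "\<rho> \<le> norm (h z)" if z: "r \<le> norm z" "norm z < 1" for z
    proof (rule ccontr)
      assume "\<not> \<rho> \<le> norm (h z)"
      then have "k z \<in> Moebius_function 0 (- w) ` cball 0 \<rho>"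
        using h_inv[OF z(2)] by (intro image_eqI[of _ _ "h z"]) auto
      then have "Fin z \<in> L"
        using L(3) fk(1)[OF z(2)] z(2) in_disk[of z] by auto
      then show False
        using r(2) z(1) by auto
    qed
    then show ?thesis
      using r(1) by blast
  qed
  let ?Q = "\<Prod>a\<in>A. [:1, - cnj a:]"
  obtain c where c: "c \<noteq> 0"
    and h_eq: "\<And>z. norm z < 1 \<Longrightarrow> h z = poly (smult c (root_poly A)) z / poly ?Q z"
    and Q0: "\<And>z. norm z < 1 \<Longrightarrow> poly ?Q z \<noteq> 0"
    using blaschke_product[OF A(1) A_sub h_hol h1 h0 dh proper] by metis
  let ?P = "smult c (root_poly A)"
  let ?W = "wronskian ?P ?Q"
  obtain a where a: "a \<in> A"
    using A d by (metis card.empty ex_in_conv not_one_le_zero)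
  then have "poly ?W a \<noteq> 0"
    using c Q0[of a] A_sub poly_root_poly_eq_0[OF A(1), of a] pderiv_root_poly_nonzero[OF A(1) a]
    by (auto simp: wronskian_def pderiv_smult)
  then have W: "?W \<noteq> 0"
    by auto
  have "{z. Fin z \<in> branch_points unit_disk f} \<subseteq> {z. poly ?W z = 0}"
  proof
    fix z assume z: "z \<in> {z. Fin z \<in> branch_points unit_disk f}"
    then have z1: "z \<in> ball 0 1"
      by (simp add: branch_points_def in_disk)
    have "deriv h z = 0"
      by (rule deriv_at_branch_point[OF _ open_ball z1 _ h_hol])
        (use z in \<open>auto simp: h_def k_def in_disk\<close>)
    then show "z \<in> {z. poly ?W z = 0}"
      using wronskian_root[OF open_ball z1, of h ?P ?Q] h_eq Q0[of z] z1 by auto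
  qed
  moreover have "degree ?P \<le> d" "degree ?Q \<le> d"
  proof -
    show "degree ?P \<le> d"
      using degree_root_poly[OF A(1)] A(2) c by simp
    \<comment> \<open>The factor belonging to \<open>a = 0\<close> is constant, hence only an
      inequality.\<close>
    have "degree ?Q \<le> (\<Sum>a\<in>A. 1)"
      by (rule order_trans[OF degree_prod_sum_le[OF A(1)]]) (intro sum_mono, simp)
    then show "degree ?Q \<le> d"
      using A(2) by simp
  qed
  note card_wronskian_roots[OF this W]
  ultimately show ?thesis
    by (meson card_mono finite_subset order_trans)
qed

section \<open>Exceptional values on the three surfaces\<close>

lemma simply_connected_surface:
  assumes "S\<^sub>0 = UNIV \<or> S\<^sub>0 = range Fin \<or> S\<^sub>0 = unit_disk"
  shows "open S\<^sub>0" "connected (Fin -` S\<^sub>0)" "ball 0 1 \<subseteq> Fin -` S\<^sub>0"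
proof -
  show "open S\<^sub>0"
    using assms by (auto intro: open_image_Fin simp: unit_disk_def)
  have "Fin -` S\<^sub>0 = UNIV \<or> Fin -` S\<^sub>0 = ball 0 1"
    using assms by (auto simp: unit_disk_def)
  then show "connected (Fin -` S\<^sub>0)" "ball 0 1 \<subseteq> Fin -` S\<^sub>0"
    by (metis connected_UNIV connected_ball, metis subset_UNIV order_refl)
qed

text \<open>On the sphere continuity at \<open>Infinity\<close> keeps \<open>f\<close> away from
  \<open>w\<close> for large arguments, on the plane properness does; both cases then have the
  rational form, while the disk has the Blaschke form.\<close>

lemma finite_exceptional_values:
  assumes S0: "S\<^sub>0 = UNIV \<or> S\<^sub>0 = range Fin \<or> S\<^sub>0 = unit_disk"
    and cov: "branched_covering S\<^sub>0 S\<^sub>0 f"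
    and deg: "covering_degree S\<^sub>0 S\<^sub>0 f = enat d" and d: "1 \<le> d"
  obtains B where "finite B" "card B \<le> 2 * d + 1"
    "Fin -` f ` branch_points S\<^sub>0 f \<subseteq> B" "Fin -` {f Infinity} \<subseteq> B"
proof -
  have S: "open S\<^sub>0" "connected (Fin -` S\<^sub>0)"
    by (rule simply_connected_surface[OF S0])+
  have "Fin -` S\<^sub>0 \<noteq> {}"
    using simply_connected_surface(3)[OF S0] by auto
  note S = S this
  obtain w where w: "Fin w \<in> S\<^sub>0" "Fin w \<notin> f ` branch_points S\<^sub>0 f" "f Infinity \<noteq> Fin w"
    by (rule exists_regular_value[OF cov S(1,3)])
  have fin: "finite {z. Fin z \<in> branch_points S\<^sub>0 f} \<and> card {z. Fin z \<in> branch_points S\<^sub>0 f} \<le> 2 * d"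
    using S0
  proof (elim disjE)
    assume X: "S\<^sub>0 = UNIV"
    have hol: "continuous_on UNIV f"
      using cov X by (simp add: branched_covering_def sphere_holomorphic_on_def)
    have "\<exists>e>0. \<exists>N. open N \<and> f Infinity \<in> N \<and> N \<inter> Fin ` ball w e = {}"
    proof (cases "f Infinity")
      case (Fin u)
      let ?e = "norm (u - w) / 2"
      have "Fin ` ball u ?e \<inter> Fin ` ball w ?e = {}"
      proof -
        have "ball u ?e \<inter> ball w ?e = {}"
          by (rule disjoint_ballI) (simp add: dist_norm)
        then show ?thesis
          by auto
      qed
      moreover have "?e > 0"
        using Fin w(3) by auto
      ultimately show ?thesis
        using Fin by (intro exI[of _ ?e] conjI exI[of _ "Fin ` ball u ?e"]) (auto intro: open_image_Fin)
    next
      case Infinity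
      \<comment> \<open>The points of modulus above \<open>norm w + 1\<close> together with
        \<open>Infinity\<close>, written in the chart at \<open>Infinity\<close>; all of
        \<open>ball w 1\<close> has smaller modulus.\<close>
      let ?N = "sphere_inverse -` Fin ` ball 0 (1 / (norm w + 1))"
      have "?N \<inter> Fin ` ball w 1 = {}"
      proof -
        have "norm u < norm w + 1" if "u \<in> ball w 1" for u
          using that norm_triangle_ineq2[of u w] by (simp add: dist_norm norm_minus_commute)
        moreover have "norm w + 1 < norm u" if "Fin u \<in> ?N" for u
        proof -
          have "u \<noteq> 0" "norm (inverse u) < 1 / (norm w + 1)"
            using that by (auto split: if_splits)
          then show ?thesis
            by (simp add: norm_inverse norm_divide field_simps add_pos_nonneg)
        qed
        ultimately show ?thesis
          by (force simp del: sphere_inverse.simps)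
      qed
      moreover have "open ?N"
        by (intro open_vimage_sphere_inverse open_image_Fin open_ball)
      moreover have "f Infinity \<in> ?N"
        unfolding Infinity by (auto simp: add_nonneg_pos intro!: image_eqI[of _ _ 0])
      ultimately show ?thesis
        by (intro exI[of _ "1::real"] conjI exI[of _ ?N]) auto
    qed
    then obtain e N where e: "e > 0" "open N" "f Infinity \<in> N" "N \<inter> Fin ` ball w e = {}"
      by blast
    have "open (f -` N)"
      using hol e(2) continuous_on_open_vimage[of UNIV f] by auto
    moreover have "Infinity \<in> f -` N"
      using e(3) by simp
    ultimately obtain R where R: "\<And>z. R < norm z \<Longrightarrow> Fin z \<in> f -` N"
      by (rule neighbourhood_of_Infinity) blast
    show ?thesis
    proof (rule finite_branch_points_rational[OF cov _ S(1,2) deg d w e(1)])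
      show "f (Fin z) \<notin> Fin ` ball w e" if "R + 1 \<le> norm z" for z
      proof -
        have "f (Fin z) \<in> N"
          using R[of z] that by simp
        then show ?thesis
          using e(4) by auto
      qed
    qed (simp add: X)
  next
    assume X: "S\<^sub>0 = range Fin"
    have "compact (Fin ` cball w 1)"
      by (intro compact_continuous_image continuous_on_Fin compact_cball)
    then obtain L where L: "compact L" "L \<subseteq> S\<^sub>0" "{x \<in> S\<^sub>0. f x \<in> Fin ` cball w 1} \<subseteq> L"
      using compact_preimage_compact[OF cov S, of "Fin ` cball w 1"] deg X by auto
    then obtain R where "R > 0" "L \<subseteq> Fin ` ball 0 R"
      using compact_subset_Fin_ball X by metis
    then have "f (Fin z) \<notin> Fin ` ball w 1" if "R \<le> norm z" for z
      using that L(3) X by force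
    then show ?thesis
      using X w by (intro finite_branch_points_rational[OF cov _ S(1,2) deg d w zero_less_one]) auto
  next
    assume "S\<^sub>0 = unit_disk"
    then show ?thesis
      using finite_branch_points_disk cov deg d w by simp
  qed
  \<comment> \<open>Adjoining \<open>Infinity\<close> to the finite branch points accounts both for
    its value and for the possibility that it is itself a branch point; this is the 1 in
    \<open>2 * d + 1\<close>.\<close>
  let ?B = "(coord \<circ> f) ` (Fin ` {z. Fin z \<in> branch_points S\<^sub>0 f} \<union> {Infinity})"
  show thesis
  proof
    show "finite ?B"
      using fin by simp
    have "card ?B \<le> card (Fin ` {z. Fin z \<in> branch_points S\<^sub>0 f} \<union> {Infinity})"
      using fin by (intro card_image_le) simp
    also have "\<dots> \<le> card (Fin ` {z. Fin z \<in> branch_points S\<^sub>0 f}) + card {Infinity}"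
      by (rule card_Un_le)
    also have "\<dots> \<le> 2 * d + 1"
      using fin card_image_le[of "{z. Fin z \<in> branch_points S\<^sub>0 f}" Fin] by auto
    finally show "card ?B \<le> 2 * d + 1" .
    show "Fin -` {f Infinity} \<subseteq> ?B"
      by (auto simp: image_iff) (metis coord.simps(1))
    show "Fin -` f ` branch_points S\<^sub>0 f \<subseteq> ?B"
    proof
      fix w assume "w \<in> Fin -` f ` branch_points S\<^sub>0 f"
      then obtain x where x: "x \<in> branch_points S\<^sub>0 f" "w = (coord \<circ> f) x"
        by (metis comp_apply coord.simps(1) imageE vimageE)
      then have "x \<in> Fin ` {z. Fin z \<in> branch_points S\<^sub>0 f} \<union> {Infinity}"
        by (cases x) auto
      then show "w \<in> ?B"
        using x(2) by (rule rev_image_eqI)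
    qed
  qed
qed

section \<open>Families of disks\<close>

text \<open>Choices at far levels are projected down, and at each level an element hit infinitely
  often is kept; it exists because the level is finite.\<close>

lemma finite_inverse_limit_nonempty:
  fixes F :: "nat \<Rightarrow> 'a set" and \<pi> :: "nat \<Rightarrow> 'a \<Rightarrow> 'a"
  assumes fin: "\<And>i. finite (F i)" and ne: "\<And>i. F i \<noteq> {}"
    and \<pi>: "\<And>i x. x \<in> F (Suc i) \<Longrightarrow> \<pi> i x \<in> F i"
  obtains x where "\<And>i. x i \<in> F i" "\<And>i. \<pi> i (x (Suc i)) = x i"
proof -
  \<comment> \<open>\<open>a k i\<close> is an arbitrary element of \<open>F (i + k)\<close>
    projected down to level \<open>i\<close>.\<close>
  define a where "a = rec_nat (\<lambda>i. SOME x. x \<in> F i) (\<lambda>_ g i. \<pi> i (g (Suc i)))"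
  have a_0: "a 0 i = (SOME x. x \<in> F i)" and a_Suc: "a (Suc k) i = \<pi> i (a k (Suc i))" for i k
    by (simp_all add: a_def)
  have a: "a k i \<in> F i" for k i
  proof (induction k arbitrary: i)
    case 0
    then show ?case
      using ne[of i] by (simp add: a_0 some_in_eq)
  qed (simp add: a_Suc \<pi>)
  let ?P = "\<lambda>i x. x \<in> F i \<and> infinite {k. a k i = x}"
  have "\<exists>x. \<forall>i. ?P i (x i) \<and> \<pi> i (x (Suc i)) = x i"
  proof (rule dependent_nat_choice)
    obtain k where "infinite {k' \<in> UNIV. a k' 0 = a k 0}"
      using pigeonhole_infinite[of UNIV "\<lambda>k. a k 0"] a fin[of 0]
      by (auto intro: finite_subset[OF _ fin[of 0]])
    then show "\<exists>x. ?P 0 x"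
      using a by auto
  next
    fix x i
    assume x: "?P i x"
    let ?K = "{k. a (Suc k) i = x}"
    \<comment> \<open>Index \<open>Suc k\<close> at level \<open>i\<close> is the projection of
      index \<open>k\<close> at level \<open>Suc i\<close>. Only index 0 has no such origin, and
      dropping it leaves an infinite set.\<close>
    have "{k. a k i = x} \<subseteq> insert 0 (Suc ` ?K)"
    proof
      fix k assume "k \<in> {k. a k i = x}"
      then show "k \<in> insert 0 (Suc ` ?K)"
        by (cases k) auto
    qed
    then have "infinite ?K"
      using x by (meson finite_imageI finite_insert finite_subset)
    then obtain k where k: "k \<in> ?K" "infinite {k' \<in> ?K. a k' (Suc i) = a k (Suc i)}"
      using pigeonhole_infinite[of ?K "\<lambda>k. a k (Suc i)"] a
        finite_subset[of "(\<lambda>k. a k (Suc i)) ` ?K" "F (Suc i)"] fin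
      by auto
    show "\<exists>y. ?P (Suc i) y \<and> \<pi> i y = x"
    proof (intro exI conjI)
      show "infinite {k'. a k' (Suc i) = a k (Suc i)}"
        using k(2) by (rule infinite_super[rotated]) auto
      show "\<pi> i (a k (Suc i)) = x"
        using k(1) by (simp add: a_Suc)
    qed (rule a)
  qed
  then show thesis
    using that by blast
qed

text \<open>Preimages of round disks need not be round, so members are only asked to be simply
  connected; a Riemann map supplies disk coordinates at the end.\<close>

definition disk_family :: "sphere set \<Rightarrow> nat \<Rightarrow> complex set set \<Rightarrow> bool" where
  "disk_family S n \<F> \<longleftrightarrow> finite \<F> \<and> n \<le> card \<F> \<and> pairwise disjnt \<F> \<and>
     (\<forall>U\<in>\<F>. open U \<and> simply_connected U \<and> U \<noteq> {} \<and> Fin ` U \<subseteq> S)"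

lemma disk_family_exists:
  assumes "ball 0 1 \<subseteq> Fin -` S"
  shows "\<exists>\<F>. disk_family S n \<F>"
proof (intro exI)
  \<comment> \<open>The spacing \<open>1 / N\<close> of the centres is twice the radius, so the
    disks are disjoint, and the last one ends before 1. The added 1 keeps \<open>N\<close> positive
    for \<open>n = 0\<close>.\<close>
  define N where "N = real n + 1"
  define b where "b k = ball (complex_of_real (real k / N)) (1 / (2 * N))" for k
  have N: "N > 0"
    by (simp add: N_def)
  have disj: "b j \<inter> b k = {}" if "j \<noteq> k" for j k
    unfolding b_def
  proof (rule disjoint_ballI)
    have "1 \<le> \<bar>real j - real k\<bar>"
      using that by linarith
    then have "1 / N \<le> \<bar>real j - real k\<bar> / N"
      using N by (simp add: divide_right_mono)
    also have "\<dots> = dist (complex_of_real (real j / N)) (complex_of_real (real k / N))"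
      unfolding dist_norm of_real_diff[symmetric] norm_of_real diff_divide_distrib[symmetric]
      using N by (simp add: abs_divide)
    finally show "1 / (2 * N) + 1 / (2 * N) \<le> \<dots>"
      by simp
  qed
  have ne: "b k \<noteq> {}" for k
    using N by (simp add: b_def)
  have sub: "b k \<subseteq> ball 0 1" if "k < n" for k
  proof
    fix z assume "z \<in> b k"
    then have "norm (z - complex_of_real (real k / N)) < 1 / (2 * N)"
      by (simp add: b_def dist_norm norm_minus_commute)
    then have "norm z < real k / N + 1 / (2 * N)"
      using norm_triangle_sub[of z "complex_of_real (real k / N)"] N
      unfolding norm_of_real by simp
    also have "\<dots> = (real k + 1/2) / N"
      using N by (simp add: field_simps)
    also have "\<dots> \<le> 1"
      using that N by (simp add: N_def)
    finally show "z \<in> ball 0 1"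
      by simp
  qed
  show "disk_family S n (b ` {..<n})"
    unfolding disk_family_def
  proof (intro conjI ballI)
    have "inj_on b {..<n}"
      using disj ne by (metis inf.idem inj_onI)
    then show "n \<le> card (b ` {..<n})"
      by (simp add: card_image)
    show "pairwise disjnt (b ` {..<n})"
    proof (rule pairwiseI)
      fix A B assume "A \<in> b ` {..<n}" "B \<in> b ` {..<n}" "A \<noteq> B"
      then obtain j k where "A = b j" "B = b k" "j \<noteq> k"
        by auto
      then show "disjnt A B"
        using disj[of j k] by (simp add: disjnt_def)
    qed
    fix U assume "U \<in> b ` {..<n}"
    then obtain k where k: "k < n" "U = b k"
      by auto
    show "open U" "simply_connected U"
      by (simp_all add: k b_def convex_imp_simply_connected)
    show "Fin ` U \<subseteq> S" "U \<noteq> {}"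
      using sub[OF k(1)] assms ne k by auto
  qed simp
qed

text \<open>
  If \<open>m \<ge> 2 d + 10\<close> then, as \<open>d \<ge> 2\<close>, also \<open>d (m - (2 d + 1)) \<ge> 9 d \<ge> 4 d + 10 \<ge> 2 d' + 10\<close>; this is
  where the bound on the growth of the degrees enters.
\<close>

lemma disk_family_preimages:
  assumes S0: "S\<^sub>0 = UNIV \<or> S\<^sub>0 = range Fin \<or> S\<^sub>0 = unit_disk"
    and cov: "branched_covering S\<^sub>0 S\<^sub>0 f" and deg: "covering_degree S\<^sub>0 S\<^sub>0 f = enat d"
    and d: "2 \<le> d" and d': "d' \<le> 2 * d" and \<F>: "disk_family S\<^sub>0 (2 * d + 10) \<F>"
  obtains \<F>' where "disk_family S\<^sub>0 (2 * d' + 10) \<F>'"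
    "\<And>U. U \<in> \<F>' \<Longrightarrow> \<exists>V\<in>\<F>. bij_betw f (Fin ` U) (Fin ` V)"
proof -
  note S = simply_connected_surface[OF S0]
  have "1 \<le> d"
    using d by simp
  obtain B where B: "finite B" "card B \<le> 2 * d + 1"
    "Fin -` f ` branch_points S\<^sub>0 f \<subseteq> B" "Fin -` {f Infinity} \<subseteq> B"
    by (rule finite_exceptional_values[OF S0 cov deg \<open>1 \<le> d\<close>])
  have fin: "finite \<F>" "2 * d + 10 \<le> card \<F>" and disj: "pairwise disjnt \<F>"
    and disk: "\<And>V. V \<in> \<F> \<Longrightarrow> open V \<and> simply_connected V \<and> V \<noteq> {} \<and> Fin ` V \<subseteq> S\<^sub>0"
    using \<F> by (auto simp: disk_family_def)
  define bad where "bad = {V \<in> \<F>. V \<inter> B \<noteq> {}}"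
  \<comment> \<open>Members are disjoint, so each exceptional value spoils at most one of
    them.\<close>
  have "card bad \<le> card B"
  proof (rule card_inj_on_le)
    let ?b = "\<lambda>V. SOME z. z \<in> V \<inter> B"
    have b: "?b V \<in> V \<inter> B" if "V \<in> bad" for V
      using that unfolding bad_def by (intro someI_ex[of "\<lambda>z. z \<in> V \<inter> B"]) blast
    show "inj_on ?b bad"
    proof (rule inj_onI)
      fix V V' assume V: "V \<in> bad" "V' \<in> bad" "?b V = ?b V'"
      then have "\<not> disjnt V V'"
        using b[OF V(1)] b[OF V(2)] unfolding disjnt_def by auto
      then show "V = V'"
        using disj V(1,2) by (auto simp: pairwise_def bad_def)
    qed
    show "?b ` bad \<subseteq> B"
      using b by blast
  qed fact
  define good where "good = \<F> - bad"
  have good_fin: "finite good"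
    using fin by (simp add: good_def)
  have "card good = card \<F> - card bad"
    unfolding good_def using fin by (intro card_Diff_subset) (auto simp: bad_def)
  then have card_good: "9 \<le> card good"
    using fin(2) B(2) \<open>card bad \<le> card B\<close> by linarith
  have good_disk: "open V" "simply_connected V" "V \<noteq> {}" "Fin ` V \<subseteq> S\<^sub>0" if "V \<in> good" for V
    using disk that by (auto simp: good_def)
  have good_disj: "V = V'" if "V \<in> good" "V' \<in> good" "z \<in> V" "z \<in> V'" for V V' z
    using disj that by (auto simp: good_def pairwise_def disjnt_def)
  have "\<forall>V\<in>good. \<exists>\<C>. finite \<C> \<and> card \<C> = d \<and> pairwise disjnt \<C> \<and>
     (\<forall>U\<in>\<C>. open U \<and> simply_connected U \<and> U \<noteq> {} \<and> Fin ` U \<subseteq> S\<^sub>0 \<and> bij_betw f (Fin ` U) (Fin ` V))"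
  proof
    fix V assume V: "V \<in> good"
    then have VB: "V \<inter> B = {}"
      by (auto simp: good_def bad_def)
    have "Fin ` V \<inter> f ` branch_points S\<^sub>0 f = {}" "f Infinity \<notin> Fin ` V"
      using B(3,4) VB by auto
    then obtain \<C> where "finite \<C>" "card \<C> = d" "pairwise disjnt \<C>"
      "\<And>U. U \<in> \<C> \<Longrightarrow> open U \<and> simply_connected U \<and> U \<noteq> {} \<and> Fin ` U \<subseteq> S\<^sub>0 \<and>
        bij_betw f (Fin ` U) (Fin ` V)"
      using simply_connected_preimages[OF cov S(1,2) deg good_disk[OF V]] by metis
    then show "\<exists>\<C>. finite \<C> \<and> card \<C> = d \<and> pairwise disjnt \<C> \<and>
     (\<forall>U\<in>\<C>. open U \<and> simply_connected U \<and> U \<noteq> {} \<and> Fin ` U \<subseteq> S\<^sub>0 \<and> bij_betw f (Fin ` U) (Fin ` V))"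
      by (intro exI[of _ \<C>]) simp
  qed
  from bchoice[OF this] obtain \<C> where "\<forall>V\<in>good. finite (\<C> V) \<and> card (\<C> V) = d \<and> pairwise disjnt (\<C> V) \<and>
     (\<forall>U\<in>\<C> V. open U \<and> simply_connected U \<and> U \<noteq> {} \<and> Fin ` U \<subseteq> S\<^sub>0 \<and> bij_betw f (Fin ` U) (Fin ` V))" ..
  then have \<C>: "finite (\<C> V)" "card (\<C> V) = d" "pairwise disjnt (\<C> V)"
    "\<And>U. U \<in> \<C> V \<Longrightarrow> open U \<and> simply_connected U \<and> U \<noteq> {} \<and> Fin ` U \<subseteq> S\<^sub>0"
    "\<And>U. U \<in> \<C> V \<Longrightarrow> bij_betw f (Fin ` U) (Fin ` V)" if "V \<in> good" for V
    using that by simp_all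
  have \<C>_disj: "V = V'" if "V \<in> good" "V' \<in> good" "U \<in> \<C> V" "U' \<in> \<C> V'" "z \<in> U" "z \<in> U'" for V V' U U' z
  proof -
    have "f (Fin z) \<in> Fin ` V" "f (Fin z) \<in> Fin ` V'"
      using \<C>(5)[OF that(1,3)] \<C>(5)[OF that(2,4)] that(5,6) by (auto simp: bij_betw_def)
    then obtain v where "v \<in> V" "v \<in> V'"
      by auto
    then show ?thesis
      by (rule good_disj[OF that(1,2)])
  qed
  define \<F>' where "\<F>' = (\<Union>V\<in>good. \<C> V)"
  have "card \<F>' = (\<Sum>V\<in>good. card (\<C> V))"
    unfolding \<F>'_def
  proof (rule card_UN_disjoint[OF good_fin])
    show "\<forall>V\<in>good. \<forall>V'\<in>good. V \<noteq> V' \<longrightarrow> \<C> V \<inter> \<C> V' = {}"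
    proof (intro ballI impI, rule ccontr)
      fix V V' assume V: "V \<in> good" "V' \<in> good" "V \<noteq> V'" "\<C> V \<inter> \<C> V' \<noteq> {}"
      then obtain U where U: "U \<in> \<C> V" "U \<in> \<C> V'"
        by auto
      then obtain z where "z \<in> U"
        using \<C>(4)[OF V(1) U(1)] by auto
      then show False
        using \<C>_disj[OF V(1,2) U] V(3) by blast
    qed
  qed (use \<C> in simp)
  then have "card \<F>' = card good * d"
    using \<C>(2) by simp
  \<comment> \<open>At least 9 members survive. The constant 10 is the least \<open>c\<close> with
    \<open>(c - 1) * d \<ge> 4 * d + c\<close> for all \<open>d \<ge> 2\<close>.\<close>
  moreover have "9 * d \<le> card good * d"
    using card_good by (rule mult_le_mono1)
  ultimately have "2 * d' + 10 \<le> card \<F>'"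
    using d d' by linarith
  moreover have "finite \<F>'"
    using good_fin \<C>(1) by (simp add: \<F>'_def)
  moreover have "pairwise disjnt \<F>'"
  proof (rule pairwiseI)
    fix U U' assume "U \<in> \<F>'" "U' \<in> \<F>'" "U \<noteq> U'"
    then obtain V V' where V: "V \<in> good" "V' \<in> good" "U \<in> \<C> V" "U' \<in> \<C> V'"
      by (auto simp: \<F>'_def)
    show "disjnt U U'"
    proof (rule ccontr)
      assume nd: "\<not> disjnt U U'"
      then obtain z where "z \<in> U" "z \<in> U'"
        by (auto simp: disjnt_def)
      then have "V = V'"
        using \<C>_disj[OF V] by blast
      then show False
        using \<C>(3)[OF V(1)] V(3,4) \<open>U \<noteq> U'\<close> nd by (auto simp: pairwise_def)
    qed
  qed
  moreover have "\<forall>U\<in>\<F>'. open U \<and> simply_connected U \<and> U \<noteq> {} \<and> Fin ` U \<subseteq> S\<^sub>0"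
  proof
    fix U assume "U \<in> \<F>'"
    then obtain V where "V \<in> good" "U \<in> \<C> V"
      by (auto simp: \<F>'_def)
    then show "open U \<and> simply_connected U \<and> U \<noteq> {} \<and> Fin ` U \<subseteq> S\<^sub>0"
      by (rule \<C>(4))
  qed
  ultimately have "disk_family S\<^sub>0 (2 * d' + 10) \<F>'"
    by (simp add: disk_family_def)
  moreover have "\<exists>V\<in>\<F>. bij_betw f (Fin ` U) (Fin ` V)" if "U \<in> \<F>'" for U
    using that \<C>(5) by (auto simp: \<F>'_def good_def)
  ultimately show thesis
    using that by blast
qed

lemma unramified_disk_sequence:
  assumes S0: "S\<^sub>0 = UNIV \<or> S\<^sub>0 = range Fin \<or> S\<^sub>0 = unit_disk"
    and cov: "\<And>i. branched_covering S\<^sub>0 S\<^sub>0 (f i)" and deg: "\<And>i. covering_degree S\<^sub>0 S\<^sub>0 (f i) = enat (d i)"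
    and d: "\<And>i. 2 \<le> d i" "\<And>i. d (Suc i) \<le> 2 * d i"
  obtains U where "\<And>i. open (U i)" "\<And>i. simply_connected (U i)" "\<And>i. U i \<noteq> {}" "\<And>i. U i \<noteq> UNIV"
    "\<And>i. Fin ` U i \<subseteq> S\<^sub>0" "\<And>i. bij_betw (f i) (Fin ` U (Suc i)) (Fin ` U i)"
proof -
  have "\<exists>F. \<forall>i. disk_family S\<^sub>0 (2 * d i + 10) (F i) \<and>
      (\<forall>U\<in>F (Suc i). \<exists>V\<in>F i. bij_betw (f i) (Fin ` U) (Fin ` V))"
  proof (rule dependent_nat_choice)
    show "\<exists>\<F>. disk_family S\<^sub>0 (2 * d 0 + 10) \<F>"
      by (rule disk_family_exists[OF simply_connected_surface(3)[OF S0]])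
    fix \<F> i
    assume "disk_family S\<^sub>0 (2 * d i + 10) \<F>"
    then obtain \<F>' where "disk_family S\<^sub>0 (2 * d (Suc i) + 10) \<F>'"
      "\<And>U. U \<in> \<F>' \<Longrightarrow> \<exists>V\<in>\<F>. bij_betw (f i) (Fin ` U) (Fin ` V)"
      using disk_family_preimages[OF S0 cov deg d] by metis
    then show "\<exists>\<F>'. disk_family S\<^sub>0 (2 * d (Suc i) + 10) \<F>' \<and>
      (\<forall>U\<in>\<F>'. \<exists>V\<in>\<F>. bij_betw (f i) (Fin ` U) (Fin ` V))"
      by (intro exI[of _ \<F>']) simp
  qed
  then obtain F where F: "\<And>i. disk_family S\<^sub>0 (2 * d i + 10) (F i)"
    and bij: "\<And>i U. U \<in> F (Suc i) \<Longrightarrow> \<exists>V\<in>F i. bij_betw (f i) (Fin ` U) (Fin ` V)"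
    by auto
  \<comment> \<open>Every member at level \<open>Suc i\<close> maps onto a member at level
    \<open>i\<close>, so taking images makes the families an inverse system of finite sets.\<close>
  let ?\<pi> = "\<lambda>i U. Fin -` f i ` Fin ` U"
  have \<pi>: "?\<pi> i U \<in> F i \<and> bij_betw (f i) (Fin ` U) (Fin ` ?\<pi> i U)" if "U \<in> F (Suc i)" for i U
  proof -
    have "\<exists>V\<in>F i. bij_betw (f i) (Fin ` U) (Fin ` V)"
      by (rule bij) fact
    then obtain V where V: "V \<in> F i" "bij_betw (f i) (Fin ` U) (Fin ` V)"
      by blast
    then have "?\<pi> i U = Fin -` Fin ` V"
      by (simp add: bij_betw_def)
    also have "\<dots> = V"
      by auto
    finally show ?thesis
      using V by simp
  qed
  have card_F: "10 \<le> card (F i)" "finite (F i)" for i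
    using F[of i] by (auto simp: disk_family_def)
  obtain U where U: "\<And>i. U i \<in> F i" "\<And>i. ?\<pi> i (U (Suc i)) = U i"
  proof (rule finite_inverse_limit_nonempty[of F ?\<pi>])
    show "F i \<noteq> {}" for i
      using card_F[of i] by auto
  qed (use \<pi> card_F in auto)
  show thesis
  proof
    fix i
    show "open (U i)" "simply_connected (U i)" "U i \<noteq> {}" "Fin ` U i \<subseteq> S\<^sub>0"
      using F[of i] U(1)[of i] by (auto simp: disk_family_def)
    show "bij_betw (f i) (Fin ` U (Suc i)) (Fin ` U i)"
      using \<pi>[OF U(1), of i] U(2) by simp
    \<comment> \<open>Another member is nonempty and disjoint from \<open>U i\<close>, which makes
      \<open>U i\<close> a proper subset of the plane, as the Riemann mapping theorem
      requires.\<close>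
    have "F i \<noteq> {U i}"
      using card_F[of i] by auto
    then obtain V where "V \<in> F i" "V \<noteq> U i"
      using U(1)[of i] by blast
    then have "disjnt V (U i)" "V \<noteq> {}"
      using F[of i] U(1)[of i] by (auto simp: disk_family_def pairwise_def)
    then show "U i \<noteq> UNIV"
      by (auto simp: disjnt_def)
  qed
qed

section \<open>Plaques of unramified disks\<close>

text \<open>Links plane holomorphy with the chart-wise definition: the choice of target chart is
  absorbed by \<open>post\<close>, the choice of source chart by precomposition with
  inversion.\<close>

lemma sphere_holomorphic_on_plane_map:
  assumes k: "k holomorphic_on U" and U: "open U" and eq: "\<And>z. z \<in> U \<Longrightarrow> \<phi> (Fin z) = Fin (k z)"
  shows "sphere_holomorphic_on \<phi> (Fin ` U)"
  unfolding sphere_holomorphic_on_def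
proof (intro conjI ballI)
  show "open (Fin ` U)"
    using U by (rule open_image_Fin)
  have "continuous_on (Fin ` U) coord"
    by (rule continuous_on_subset[OF continuous_on_coord]) auto
  moreover have "continuous_on (coord ` Fin ` U) k"
    using holomorphic_on_imp_continuous_on[OF k] by (simp add: image_image)
  ultimately have "continuous_on (Fin ` U) (k \<circ> coord)"
    by (rule continuous_on_compose)
  then have "continuous_on (Fin ` U) (Fin \<circ> (k \<circ> coord))"
    by (rule continuous_on_compose) (rule continuous_on_Fin)
  then show "continuous_on (Fin ` U) \<phi>"
    by (rule continuous_on_eq) (auto simp: eq)
  have post: "(\<lambda>z. coord (b (Fin (h z)))) holomorphic_on {z \<in> T. b (Fin (h z)) \<noteq> Infinity}"
    if "b \<in> {id, sphere_inverse}" "h holomorphic_on T" for b h T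
  proof (cases "b = id")
    case True
    then show ?thesis
      using that(2) by simp
  next
    case False
    then have b: "b = sphere_inverse"
      using that(1) by simp
    have "(\<lambda>z. inverse (h z)) holomorphic_on {z \<in> T. h z \<noteq> 0}"
      using that(2) by (intro holomorphic_intros) (auto intro: holomorphic_on_subset)
    moreover have "{z \<in> T. b (Fin (h z)) \<noteq> Infinity} = {z \<in> T. h z \<noteq> 0}"
      by (auto simp: b)
    ultimately show ?thesis
      by (auto simp: b elim: holomorphic_transform)
  qed
  fix a b :: "sphere \<Rightarrow> sphere"
  assume a: "a \<in> {id, sphere_inverse}" and b: "b \<in> {id, sphere_inverse}"
  show "(\<lambda>z. coord (b (\<phi> (a (Fin z))))) holomorphic_on
      {z. a (Fin z) \<in> Fin ` U \<and> b (\<phi> (a (Fin z))) \<noteq> Infinity}"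
  proof (cases "a = id")
    case True
    have "(\<lambda>z. coord (b (Fin (k z)))) holomorphic_on {z \<in> U. b (Fin (k z)) \<noteq> Infinity}"
      by (rule post[OF b k])
    moreover have "{z. a (Fin z) \<in> Fin ` U \<and> b (\<phi> (a (Fin z))) \<noteq> Infinity} =
        {z \<in> U. b (Fin (k z)) \<noteq> Infinity}"
      by (auto simp: True eq)
    ultimately show ?thesis
      by (auto simp: True eq elim!: holomorphic_transform)
  next
    case False
    then have a: "a = sphere_inverse"
      using a by simp
    let ?T = "{z. z \<noteq> 0 \<and> inverse z \<in> U}"
    have "(\<lambda>z. k (inverse z)) holomorphic_on ?T"
    proof -
      have "(\<lambda>z. inverse z) holomorphic_on ?T"
        by (intro holomorphic_intros) auto
      then have "k \<circ> (\<lambda>z. inverse z) holomorphic_on ?T"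
        using k by (rule holomorphic_on_compose_gen) auto
      then show ?thesis
        by (simp add: o_def)
    qed
    then have "(\<lambda>z. coord (b (Fin (k (inverse z))))) holomorphic_on
        {z \<in> ?T. b (Fin (k (inverse z))) \<noteq> Infinity}"
      by (rule post[OF b])
    moreover have "{z. a (Fin z) \<in> Fin ` U \<and> b (\<phi> (a (Fin z))) \<noteq> Infinity} =
        {z \<in> ?T. b (Fin (k (inverse z))) \<noteq> Infinity}"
      by (auto simp: a eq split: if_splits)
    ultimately show ?thesis
      by (auto simp: a eq elim!: holomorphic_transform)
  qed
qed

lemma conformal_equivalence_unit_disk:
  assumes k: "k holomorphic_on U" "inj_on k U" "k ` U = ball 0 1" and U: "open U"
  shows "conformal_equivalence (Fin ` U) unit_disk (\<lambda>p. Fin (k (coord p)))"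
proof -
  let ?\<phi> = "\<lambda>p. Fin (k (coord p))"
  obtain h where h: "h holomorphic_on k ` U" "\<And>z. z \<in> U \<Longrightarrow> h (k z) = z"
    using holomorphic_has_inverse[OF k(1) U k(2)] by metis
  have bij: "bij_betw ?\<phi> (Fin ` U) unit_disk"
    unfolding bij_betw_def using k by (auto simp: inj_on_def unit_disk_def image_image simp flip: k(3))
  have "inv_into (Fin ` U) ?\<phi> (Fin w) = Fin (h w)" if w: "w \<in> ball 0 1" for w
  proof -
    have "w \<in> k ` U"
      using w k(3) by simp
    then obtain z where z: "z \<in> U" "w = k z"
      by auto
    then have "inv_into (Fin ` U) ?\<phi> (?\<phi> (Fin z)) = Fin z"
      using bij by (intro inv_into_f_f) (auto simp: bij_betw_def)
    then show ?thesis
      using z h(2) by simp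
  qed
  then have "sphere_holomorphic_on (inv_into (Fin ` U) ?\<phi>) (Fin ` ball 0 1)"
    using h(1) k(3) by (intro sphere_holomorphic_on_plane_map[of h]) auto
  then show ?thesis
    using bij sphere_holomorphic_on_plane_map[OF k(1) U, of ?\<phi>]
    by (simp add: conformal_equivalence_def unit_disk_def)
qed

theorem lemma4:
  fixes S\<^sub>0 :: "sphere set" and f :: "nat \<Rightarrow> sphere \<Rightarrow> sphere"
  assumes "S\<^sub>0 = UNIV \<or> S\<^sub>0 = range Fin \<or> S\<^sub>0 = unit_disk"
    and "\<And>i. branched_covering S\<^sub>0 S\<^sub>0 (f i)"
    and "\<And>i. 1 < covering_degree S\<^sub>0 S\<^sub>0 (f i)"
    and "\<And>i. covering_degree S\<^sub>0 S\<^sub>0 (f i) < \<infinity>"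
    and "\<And>i. covering_degree S\<^sub>0 S\<^sub>0 (f (Suc i)) \<le> 2 * covering_degree S\<^sub>0 S\<^sub>0 (f i)"
  shows "regular_points (\<lambda>_. S\<^sub>0) f \<noteq> {}"
proof -
  define d where "d i = the_enat (covering_degree S\<^sub>0 S\<^sub>0 (f i))" for i
  have deg: "covering_degree S\<^sub>0 S\<^sub>0 (f i) = enat (d i)" for i
    using assms(4)[of i] by (auto simp: d_def)
  have d: "2 \<le> d i" "d (Suc i) \<le> 2 * d i" for i
    using assms(3)[of i] assms(5)[of i] by (simp_all add: deg one_enat_def numeral_eq_enat)
  obtain U where U: "\<And>i. open (U i)" "\<And>i. simply_connected (U i)" "\<And>i. U i \<noteq> {}" "\<And>i. U i \<noteq> UNIV"
    "\<And>i. Fin ` U i \<subseteq> S\<^sub>0" and bij: "\<And>i. bij_betw (f i) (Fin ` U (Suc i)) (Fin ` U i)"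
    using unramified_disk_sequence[where f = f and d = d, OF assms(1,2) deg d] by metis
  have riemann: "\<exists>k. k holomorphic_on U i \<and> inj_on k (U i) \<and> k ` U i = ball 0 1" for i
  proof -
    obtain k h where k: "k holomorphic_on U i" "\<forall>z\<in>U i. k z \<in> ball 0 1 \<and> h (k z) = z"
      "\<forall>z\<in>ball 0 1. h z \<in> U i \<and> k (h z) = z"
      using Riemann_mapping_theorem[of "U i"] U by auto
    have "inj_on k (U i)"
      by (rule inj_on_inverseI[of _ h]) (use k(2) in blast)
    moreover have "k ` U i = ball 0 1"
    proof (intro subset_antisym subsetI)
      fix w assume "w \<in> ball (0::complex) 1"
      then show "w \<in> k ` U i"
        using k(3) by (intro image_eqI[of _ _ "h w"]) auto
    qed (use k(2) in auto)
    ultimately show ?thesis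
      using k(1) by blast
  qed
  have hol: "sphere_holomorphic_on (f i) S\<^sub>0" and onto: "f i ` S\<^sub>0 = S\<^sub>0" for i
    using assms(2)[of i] by (simp_all add: branched_covering_def)
  have "plaque (\<lambda>_. S\<^sub>0) f (\<lambda>i. Fin ` U i)"
    unfolding plaque_def open_sequence_def
  proof (intro conjI allI)
    fix i
    show "open (Fin ` U i)"
      by (intro open_image_Fin U)
    show "Fin ` U i \<subseteq> S\<^sub>0"
      by (rule U)
    show "f i ` Fin ` U (Suc i) = Fin ` U i"
      using bij[of i] by (simp add: bij_betw_def)
    obtain k where k: "k holomorphic_on U i" "inj_on k (U i)" "k ` U i = ball 0 1"
      using riemann by blast
    then have \<psi>: "conformal_equivalence (Fin ` U i) unit_disk (\<lambda>p. Fin (k (coord p)))"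
      using U(1) by (intro conformal_equivalence_unit_disk)
    then show "\<exists>\<phi>. conformal_equivalence (Fin ` U i) unit_disk \<phi>"
      by blast
    define g where "g z = coord (f i (Fin z))" for z
    have g: "f i (Fin z) = Fin (g z)" "g z \<in> U i" if "z \<in> U (Suc i)" for z
    proof -
      have "f i (Fin z) \<in> Fin ` U i"
        using bij[of i] that by (auto simp: bij_betw_def)
      then show "f i (Fin z) = Fin (g z)" "g z \<in> U i"
        by (auto simp: g_def)
    qed
    have g_bij: "bij_betw g (U (Suc i)) (U i)"
    proof (rule bij_betw_imageI)
      show "inj_on g (U (Suc i))"
      proof (rule inj_onI)
        fix x y assume xy: "x \<in> U (Suc i)" "y \<in> U (Suc i)" "g x = g y"
        then have "f i (Fin x) = f i (Fin y)"
          using g by simp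
        then show "x = y"
          using bij[of i] xy by (auto simp: bij_betw_def inj_on_def)
      qed
      have "Fin ` g ` U (Suc i) = Fin ` U i"
        using bij[of i] g by (auto simp: bij_betw_def image_image)
      then show "g ` U (Suc i) = U i"
        by (simp add: inj_image_eq_iff inj_def)
    qed
    have "g holomorphic_on U (Suc i)"
      unfolding g_def
      by (rule holomorphic_on_subset[OF sphere_holomorphic_on_coord(1)[OF hol]])
        (use g U(5)[of "Suc i"] in auto)
    \<comment> \<open>The coordinate on \<open>U (Suc i)\<close> is that of \<open>U i\<close>
      pulled back along \<open>f i\<close>. In these two coordinates \<open>f i\<close> is the
      identity, the power map with exponent 1.\<close>
    then have "k \<circ> g holomorphic_on U (Suc i)"
      using k(1) g(2) by (intro holomorphic_on_compose_gen[of g _ k "U i"]) auto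
    moreover have "bij_betw (k \<circ> g) (U (Suc i)) (ball 0 1)"
      using g_bij k(2,3) by (intro bij_betw_trans[of g _ "U i"]) (auto simp: bij_betw_def)
    ultimately have \<phi>: "conformal_equivalence (Fin ` U (Suc i)) unit_disk (\<lambda>p. Fin ((k \<circ> g) (coord p)))"
      unfolding bij_betw_def using U(1) by (intro conformal_equivalence_unit_disk) blast+
    have "power_map_in_coords (Fin ` U (Suc i)) (Fin ` U i) (f i) (\<lambda>p. Fin ((k \<circ> g) (coord p)))
        (\<lambda>p. Fin (k (coord p))) 1"
      unfolding power_map_in_coords_def using \<phi> \<psi> g by auto
    moreover have "enat 1 \<le> covering_degree S\<^sub>0 S\<^sub>0 (f i)"
      using d(1)[of i] by (simp add: deg)
    ultimately show "\<exists>\<phi> \<psi> t. power_map_in_coords (Fin ` U (Suc i)) (Fin ` U i) (f i) \<phi> \<psi> t \<and>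
        enat t \<le> covering_degree S\<^sub>0 S\<^sub>0 (f i)"
      by blast
  qed
  \<comment> \<open>Each restriction is onto, so a thread can start at any point of
    \<open>U 0\<close> and be continued upwards.\<close>
  moreover obtain x where x: "x \<in> threads f (\<lambda>i. Fin ` U i)"
  proof -
    have "\<exists>x. \<forall>i. x i \<in> Fin ` U i \<and> f i (x (Suc i)) = x i"
    proof (rule dependent_nat_choice)
      show "\<exists>p. p \<in> Fin ` U 0"
        using U(3)[of 0] by blast
      show "\<exists>q. q \<in> Fin ` U (Suc i) \<and> f i q = p" if "p \<in> Fin ` U i" for p i
      proof -
        have "p \<in> f i ` Fin ` U (Suc i)"
          using bij[of i] that by (simp add: bij_betw_def)
        then show ?thesis
          by auto
      qed
    qed
    then show thesis
      using that by (auto simp: threads_def)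
  qed
  moreover have "x \<in> topspace (plaque_inverse_limit (\<lambda>_. S\<^sub>0) f)"
  proof -
    have "open S\<^sub>0"
      by (rule simply_connected_surface(1)[OF assms(1)])
    then have "topspace (plaque_inverse_limit (\<lambda>_. S\<^sub>0) f) = threads f (\<lambda>_. S\<^sub>0)"
      using onto by (intro topspace_plaque_inverse_limit)
    then show ?thesis
      using x U(5) unfolding threads_def by blast
  qed
  \<comment> \<open>Bijectivity holds at every level, so the threshold in the definition can be
    0.\<close>
  ultimately have "x \<in> regular_points (\<lambda>_. S\<^sub>0) f"
    unfolding regular_points_def using bij by blast
  then show ?thesis
    by blast
qed

end
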